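(* Let $\mu$ be $\sigma$-finite, let $1<q<\infty$ with conjugate exponent $p$, and let $\{\Lambda_\omega\in B(X,H_\omega):\omega\in\Omega\}$ be a family of bounded operators. (i) Assume that for each $x\in X$ the map $\omega\mapsto\Lambda_\omega(x)$ is Bochner measurable. Then $\{\Lambda_\omega\}_{\omega\in\Omega}$ is a Bochner $qg$-Riesz basis for $X^*$ with respect to $\{H_\omega\}_{\omega\in\Omega}$ if and only if the operator $T$ given by $\langle x,TG\rangle=\int_\Omega\langle\Lambda_\omega(x),G(\omega)\rangle\,d\mu(\omega)$ ($x\in X$, $G\in L^q(\mu,\oplus_{\omega\in\Omega}H_\omega)$) is a (well-defined) invertible bounded operator from $L^q(\mu,\oplus_{\omega\in\Omega}H_\omega)$ onto $X^*$. (ii) Let $\{\Lambda_\omega\}_{\omega\in\Omega}$ be a Bochner $qg$-Riesz basis for $X^*$ with respect to $\{H_\omega\}_{\omega\in\Omega}$ with optimal upper Bochner $qg$-Riesz basis bound $B$. Then $\{\Lambda_\omega\}_{\omega\in\Omega}$ is a Bochner $pg$-frame for $X$ with respect to $\{H_\omega\}_{\omega\in\Omega}$ with optimal upper Bochner $pg$-frame bound $B$.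
   Context: $X$ is a Banach space, $(\Omega,\Sigma,\mu)$ is a measure space with $\mu$ a positive measure, and $\{H_\omega\}_{\omega\in\Omega}$ is a family of Hilbert spaces. $B(X,H_\omega)$ is the space of bounded linear operators from $X$ to $H_\omega$. Put $K=\oplus_{\omega\in\Omega}H_\omega$ (Hilbert space direct sum), with each $H_\omega$ regarded as a subspace of $K$. A function $f$ from $\Omega$ to a Banach space is Bochner measurable if there are simple functions $f_n$ with $\|f_n(\omega)-f(\omega)\|\to0$ for $\mu$-a.e. $\omega$. For $1\le r<\infty$, $L^r(\mu,K)$ is the Bochner space of (classes of) Bochner measurable $F:\Omega\to K$ with $\|F\|_r=(\int_\Omega\|F(\omega)\|^r d\mu(\omega))^{1/r}<\infty$. Pairing: $\nu:K\to K^*$ is a fixed isometric (linear) isomorphism between $K$ and $K^*$, and for $u,v\in K$, $\langle u,v\rangle:=\nu(v)(u)$ (not the inner product). For $x\in X$, $x^*\in X^*$, $\langle x,x^*\rangle=x^*(x)$. Bochner $pg$-frame ($1<p<\infty$): a family $\{\Lambda_\omega\in B(X,H_\omega)\}_{\omega\in\Omega}$ is a Bochner $pg$-frame for $X$ with respect to $\{H_\omega\}_{\omega\in\Omega}$ if (i) for each $x\in X$, $\omega\mapsto\Lambda_\omega(x)$ is Bochner measurable, and (ii) there are positive constants $A,B$ with $A\|x\|\le(\int_\Omega\|\Lambda_\omega(x)\|^p d\mu(\omega))^{1/p}\le B\|x\|$ for all $x\in X$. $A$ and $B$ are called lower and upper Bochner $pg$-frame bounds; the optimal upper bound is the smallest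 possible $B$. "$T$ is well-defined" means that for all $x\in X$ and $G\in L^q(\mu,K)$ the integral defining $\langle x,TG\rangle$ exists and is finite, and that $TG\in X^*$. Bochner $qg$-Riesz basis ($1<q<\infty$): a family $\{\Lambda_\omega\in B(X,H_\omega)\}_{\omega\in\Omega}$ is a Bochner $qg$-Riesz basis for $X^*$ with respect to $\{H_\omega\}_{\omega\in\Omega}$ if (i) $\{x\in X:\Lambda_\omega x=0\ \text{for }\mu\text{-a.e. }\omega\}=\{0\}$; and (ii) for each $x\in X$, $\omega\mapsto\Lambda_\omega(x)$ is Bochner measurable, the operator $T:L^q(\mu,K)\to X^*$, $\langle x,TG\rangle=\int_\Omega\langle\Lambda_\omega(x),G(\omega)\rangle d\mu(\omega)$, is well-defined, and there are positive constants $A,B$ with $A\|G\|_q\le\|TG\|\le B\|G\|_q$ for all $G\in L^q(\mu,K)$. $A$ and $B$ are called lower and upper Bochner $qg$-Riesz basis bounds; the optimal upper bound is the smallest possible $B$. *)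

theory Defs
  imports "HOL-Analysis.Analysis"
begin

text \<open>The scalar field is a type of sort \<open>{real_normed_field, euclidean_space}\<close>. A finite-dimensional
  commutative division algebra over the reals is isomorphic to the reals or to the complex numbers
  (Frobenius), so this sort treats exactly the real and the complex case uniformly. In both cases
  \<open>inner 1 a\<close> is the real part of \<open>a\<close>, which gives the formula for conjugation.\<close>

definition scalar_cnj :: "'s::{real_normed_field, euclidean_space} \<Rightarrow> 's" where
  "scalar_cnj a = of_real (2 * inner 1 a) - a"

lemma scalar_cnj_real: "scalar_cnj (a :: real) = a"
  by (simp add: scalar_cnj_def)

lemma scalar_cnj_complex: "scalar_cnj (z :: complex) = cnj z"
  by (simp add: scalar_cnj_def inner_complex_def complex_eq_iff)


section \<open>Banach and Hilbert spaces over the scalar field\<close>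

text \<open>The type supplies addition, norm and completeness; the argument supplies the action of the
  scalar field, which extends the real scalar multiplication of the type.\<close>

definition banach_space_over ::
    "('s::{real_normed_field, euclidean_space} \<Rightarrow> 'x::banach \<Rightarrow> 'x) \<Rightarrow> bool" where
  "banach_space_over sX \<longleftrightarrow>
     vector_space sX \<and>
     (\<forall>r x. sX (of_real r) x = r *\<^sub>R x) \<and>
     (\<forall>c x. norm (sX c x) = norm c * norm x)"

definition hilbert_space_over ::
    "('s::{real_normed_field, euclidean_space} \<Rightarrow> 'k::banach \<Rightarrow> 'k) \<Rightarrow> ('k \<Rightarrow> 'k \<Rightarrow> 's) \<Rightarrow> bool" where
  "hilbert_space_over sK ip \<longleftrightarrow>
     banach_space_over sK \<and>
     (\<forall>v. Vector_Spaces.linear sK (*) (\<lambda>u. ip u v)) \<and>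
     (\<forall>u v. ip v u = scalar_cnj (ip u v)) \<and>
     (\<forall>u. ip u u = of_real ((norm u)\<^sup>2))"

definition bounded_ops ::
    "('s::{real_normed_field, euclidean_space} \<Rightarrow> 'x::banach \<Rightarrow> 'x) \<Rightarrow>
     ('s \<Rightarrow> 'y::banach \<Rightarrow> 'y) \<Rightarrow> ('x \<Rightarrow> 'y) set" where
  "bounded_ops sX sY =
     {f. Vector_Spaces.linear sX sY f \<and> (\<exists>C. \<forall>x. norm (f x) \<le> C * norm x)}"

text \<open>The norm of a functional in the dual space is \<open>onorm\<close>.\<close>

definition dual_space ::
    "('s::{real_normed_field, euclidean_space} \<Rightarrow> 'x::banach \<Rightarrow> 'x) \<Rightarrow> ('x \<Rightarrow> 's) set" where
  "dual_space sX = bounded_ops sX (*)"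

definition isometric_dual_iso ::
    "('s::{real_normed_field, euclidean_space} \<Rightarrow> 'k::banach \<Rightarrow> 'k) \<Rightarrow> ('k \<Rightarrow> 'k \<Rightarrow> 's) \<Rightarrow> bool" where
  "isometric_dual_iso sK \<nu> \<longleftrightarrow>
     bij_betw \<nu> UNIV (dual_space sK) \<and>
     (\<forall>v w. \<nu> (v + w) = (\<lambda>u. \<nu> v u + \<nu> w u)) \<and>
     (\<forall>c v. \<nu> (sK c v) = (\<lambda>u. c * \<nu> v u)) \<and>
     (\<forall>v. onorm (\<nu> v) = norm v)"

text \<open>The Hilbert space carried by the type \<open>'k\<close> is the Hilbert space direct sum of the spaces
  \<open>H \<omega>\<close>, \<open>\<omega> \<in> \<Omega>\<close>, each regarded as a (closed) subspace of the sum.\<close>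

definition hilbert_direct_sum ::
    "('s::{real_normed_field, euclidean_space} \<Rightarrow> 'k::banach \<Rightarrow> 'k) \<Rightarrow> ('k \<Rightarrow> 'k \<Rightarrow> 's) \<Rightarrow>
     'w set \<Rightarrow> ('w \<Rightarrow> 'k set) \<Rightarrow> bool" where
  "hilbert_direct_sum sK ip \<Omega> H \<longleftrightarrow>
     hilbert_space_over sK ip \<and>
     (\<forall>\<omega>\<in>\<Omega>. module.subspace sK (H \<omega>) \<and> closed (H \<omega>)) \<and>
     (\<forall>\<omega>\<in>\<Omega>. \<forall>\<omega>'\<in>\<Omega>. \<omega> \<noteq> \<omega>' \<longrightarrow> (\<forall>u\<in>H \<omega>. \<forall>v\<in>H \<omega>'. ip u v = 0)) \<and>
     closure (module.span sK (\<Union>\<omega>\<in>\<Omega>. H \<omega>)) = UNIV"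


section \<open>Bochner spaces\<close>

text \<open>Borel measurability would be too weak here, since \<open>'k\<close> need not be separable. A Bochner
  measurable function is determined by \<open>M\<close> only up to null sets and its norm need not be
  measurable with respect to \<open>M\<close>; integrals are therefore taken over \<open>completion M\<close>.\<close>

definition bochner_measurable :: "'w measure \<Rightarrow> ('w \<Rightarrow> 'k::banach) \<Rightarrow> bool" where
  "bochner_measurable M f \<longleftrightarrow>
     (\<exists>s :: nat \<Rightarrow> 'w \<Rightarrow> 'k. (\<forall>n. simple_function M (s n)) \<and>
        (AE \<omega> in M. (\<lambda>n. norm (s n \<omega> - f \<omega>)) \<longlonglongrightarrow> 0))"

definition Lp_finite :: "'w measure \<Rightarrow> real \<Rightarrow> ('w \<Rightarrow> 'k::banach) \<Rightarrow> bool" where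
  "Lp_finite M r F \<longleftrightarrow> (\<integral>\<^sup>+\<omega>. ennreal (norm (F \<omega>) powr r) \<partial>completion M) < \<infinity>"

text \<open>Meaningful only under \<open>Lp_finite M r F\<close>, as \<open>enn2real \<infinity> = 0\<close>.\<close>

definition Lp_norm :: "'w measure \<Rightarrow> real \<Rightarrow> ('w \<Rightarrow> 'k::banach) \<Rightarrow> real" where
  "Lp_norm M r F =
     enn2real (\<integral>\<^sup>+\<omega>. ennreal (norm (F \<omega>) powr r) \<partial>completion M) powr (1 / r)"

text \<open>Elements of the Bochner space are represented by functions; equality of classes is equality
  almost everywhere.\<close>

definition Lp_space :: "'w measure \<Rightarrow> real \<Rightarrow> ('w \<Rightarrow> 'k::banach) set" where
  "Lp_space M r = {F. bochner_measurable M F \<and> Lp_finite M r F}"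


section \<open>Bochner pg-frames and qg-Riesz bases\<close>

definition operator_family ::
    "('s::{real_normed_field, euclidean_space} \<Rightarrow> 'x::banach \<Rightarrow> 'x) \<Rightarrow>
     ('s \<Rightarrow> 'k::banach \<Rightarrow> 'k) \<Rightarrow> 'w set \<Rightarrow> ('w \<Rightarrow> 'k set) \<Rightarrow> ('w \<Rightarrow> 'x \<Rightarrow> 'k) \<Rightarrow> bool" where
  "operator_family sX sK \<Omega> H \<Lambda> \<longleftrightarrow>
     (\<forall>\<omega>\<in>\<Omega>. \<Lambda> \<omega> \<in> bounded_ops sX sK \<and> range (\<Lambda> \<omega>) \<subseteq> H \<omega>)"

definition pg_frame_bounds ::
    "'w measure \<Rightarrow> real \<Rightarrow> ('w \<Rightarrow> 'x::banach \<Rightarrow> 'k::banach) \<Rightarrow> real \<Rightarrow> real \<Rightarrow> bool" where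
  "pg_frame_bounds M p \<Lambda> A B \<longleftrightarrow>
     0 < A \<and> 0 < B \<and>
     (\<forall>x. Lp_finite M p (\<lambda>\<omega>. \<Lambda> \<omega> x) \<and>
          A * norm x \<le> Lp_norm M p (\<lambda>\<omega>. \<Lambda> \<omega> x) \<and>
          Lp_norm M p (\<lambda>\<omega>. \<Lambda> \<omega> x) \<le> B * norm x)"

definition bochner_pg_frame ::
    "('s::{real_normed_field, euclidean_space} \<Rightarrow> 'x::banach \<Rightarrow> 'x) \<Rightarrow>
     ('s \<Rightarrow> 'k::banach \<Rightarrow> 'k) \<Rightarrow> 'w measure \<Rightarrow> ('w \<Rightarrow> 'k set) \<Rightarrow> real \<Rightarrow>
     ('w \<Rightarrow> 'x \<Rightarrow> 'k) \<Rightarrow> bool" where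
  "bochner_pg_frame sX sK M H p \<Lambda> \<longleftrightarrow>
     operator_family sX sK (space M) H \<Lambda> \<and>
     (\<forall>x. bochner_measurable M (\<lambda>\<omega>. \<Lambda> \<omega> x)) \<and>
     (\<exists>A B. pg_frame_bounds M p \<Lambda> A B)"

definition optimal_upper_pg_frame_bound ::
    "'w measure \<Rightarrow> real \<Rightarrow> ('w \<Rightarrow> 'x::banach \<Rightarrow> 'k::banach) \<Rightarrow> real \<Rightarrow> bool" where
  "optimal_upper_pg_frame_bound M p \<Lambda> B \<longleftrightarrow>
     (\<exists>A. pg_frame_bounds M p \<Lambda> A B) \<and>
     (\<forall>A' B'. pg_frame_bounds M p \<Lambda> A' B' \<longrightarrow> B \<le> B')"

text \<open>\<open>synthesis M \<nu> \<Lambda> G\<close> is the functional \<open>T G\<close>, where the pairing of \<open>u\<close> and \<open>v\<close> is \<open>\<nu> v u\<close>.\<close>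

definition synthesis ::
    "'w measure \<Rightarrow> ('k::banach \<Rightarrow> 'k \<Rightarrow> 's::{real_normed_field, euclidean_space}) \<Rightarrow>
     ('w \<Rightarrow> 'x::banach \<Rightarrow> 'k) \<Rightarrow> ('w \<Rightarrow> 'k) \<Rightarrow> 'x \<Rightarrow> 's" where
  "synthesis M \<nu> \<Lambda> G = (\<lambda>x. \<integral>\<omega>. \<nu> (G \<omega>) (\<Lambda> \<omega> x) \<partial>completion M)"

definition synthesis_well_defined ::
    "('s::{real_normed_field, euclidean_space} \<Rightarrow> 'x::banach \<Rightarrow> 'x) \<Rightarrow> 'w measure \<Rightarrow>
     ('k::banach \<Rightarrow> 'k \<Rightarrow> 's) \<Rightarrow> real \<Rightarrow> ('w \<Rightarrow> 'x \<Rightarrow> 'k) \<Rightarrow> bool" where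
  "synthesis_well_defined sX M \<nu> q \<Lambda> \<longleftrightarrow>
     (\<forall>G\<in>Lp_space M q.
        (\<forall>x. integrable (completion M) (\<lambda>\<omega>. \<nu> (G \<omega>) (\<Lambda> \<omega> x))) \<and>
        synthesis M \<nu> \<Lambda> G \<in> dual_space sX)"

definition qg_riesz_bounds ::
    "'w measure \<Rightarrow> ('k::banach \<Rightarrow> 'k \<Rightarrow> 's::{real_normed_field, euclidean_space}) \<Rightarrow> real \<Rightarrow>
     ('w \<Rightarrow> 'x::banach \<Rightarrow> 'k) \<Rightarrow> real \<Rightarrow> real \<Rightarrow> bool" where
  "qg_riesz_bounds M \<nu> q \<Lambda> A B \<longleftrightarrow>
     0 < A \<and> 0 < B \<and>
     (\<forall>G\<in>Lp_space M q.
        A * Lp_norm M q G \<le> onorm (synthesis M \<nu> \<Lambda> G) \<and>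
        onorm (synthesis M \<nu> \<Lambda> G) \<le> B * Lp_norm M q G)"

definition bochner_qg_riesz_basis ::
    "('s::{real_normed_field, euclidean_space} \<Rightarrow> 'x::banach \<Rightarrow> 'x) \<Rightarrow>
     ('s \<Rightarrow> 'k::banach \<Rightarrow> 'k) \<Rightarrow> 'w measure \<Rightarrow> ('w \<Rightarrow> 'k set) \<Rightarrow> ('k \<Rightarrow> 'k \<Rightarrow> 's) \<Rightarrow> real \<Rightarrow>
     ('w \<Rightarrow> 'x \<Rightarrow> 'k) \<Rightarrow> bool" where
  "bochner_qg_riesz_basis sX sK M H \<nu> q \<Lambda> \<longleftrightarrow>
     operator_family sX sK (space M) H \<Lambda> \<and>
     {x. AE \<omega> in M. \<Lambda> \<omega> x = 0} = {0} \<and>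
     (\<forall>x. bochner_measurable M (\<lambda>\<omega>. \<Lambda> \<omega> x)) \<and>
     synthesis_well_defined sX M \<nu> q \<Lambda> \<and>
     (\<exists>A B. qg_riesz_bounds M \<nu> q \<Lambda> A B)"

definition optimal_upper_qg_riesz_bound ::
    "'w measure \<Rightarrow> ('k::banach \<Rightarrow> 'k \<Rightarrow> 's::{real_normed_field, euclidean_space}) \<Rightarrow> real \<Rightarrow>
     ('w \<Rightarrow> 'x::banach \<Rightarrow> 'k) \<Rightarrow> real \<Rightarrow> bool" where
  "optimal_upper_qg_riesz_bound M \<nu> q \<Lambda> B \<longleftrightarrow>
     (\<exists>A. qg_riesz_bounds M \<nu> q \<Lambda> A B) \<and>
     (\<forall>A' B'. qg_riesz_bounds M \<nu> q \<Lambda> A' B' \<longrightarrow> B \<le> B')"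


section \<open>Invertible bounded operators from a Bochner space onto a dual space\<close>

text \<open>Operators on the Bochner space act on representatives: they respect equality almost
  everywhere, and identities between elements of the Bochner space hold almost everywhere.\<close>

definition bounded_op_Lp_dual ::
    "('s::{real_normed_field, euclidean_space} \<Rightarrow> 'x::banach \<Rightarrow> 'x) \<Rightarrow>
     ('s \<Rightarrow> 'k::banach \<Rightarrow> 'k) \<Rightarrow> 'w measure \<Rightarrow> real \<Rightarrow> (('w \<Rightarrow> 'k) \<Rightarrow> ('x \<Rightarrow> 's)) \<Rightarrow> bool" where
  "bounded_op_Lp_dual sX sK M q T \<longleftrightarrow>
     (\<forall>G\<in>Lp_space M q. T G \<in> dual_space sX) \<and>
     (\<forall>F\<in>Lp_space M q. \<forall>G\<in>Lp_space M q. (AE \<omega> in M. F \<omega> = G \<omega>) \<longrightarrow> T F = T G) \<and>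
     (\<forall>F\<in>Lp_space M q. \<forall>G\<in>Lp_space M q. T (\<lambda>\<omega>. F \<omega> + G \<omega>) = (\<lambda>x. T F x + T G x)) \<and>
     (\<forall>c. \<forall>G\<in>Lp_space M q. T (\<lambda>\<omega>. sK c (G \<omega>)) = (\<lambda>x. c * T G x)) \<and>
     (\<exists>C. \<forall>G\<in>Lp_space M q. onorm (T G) \<le> C * Lp_norm M q G)"

definition bounded_op_dual_Lp ::
    "('s::{real_normed_field, euclidean_space} \<Rightarrow> 'x::banach \<Rightarrow> 'x) \<Rightarrow>
     ('s \<Rightarrow> 'k::banach \<Rightarrow> 'k) \<Rightarrow> 'w measure \<Rightarrow> real \<Rightarrow> (('x \<Rightarrow> 's) \<Rightarrow> ('w \<Rightarrow> 'k)) \<Rightarrow> bool" where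
  "bounded_op_dual_Lp sX sK M q S \<longleftrightarrow>
     (\<forall>f\<in>dual_space sX. S f \<in> Lp_space M q) \<and>
     (\<forall>f\<in>dual_space sX. \<forall>g\<in>dual_space sX.
        AE \<omega> in M. S (\<lambda>x. f x + g x) \<omega> = S f \<omega> + S g \<omega>) \<and>
     (\<forall>c. \<forall>f\<in>dual_space sX. AE \<omega> in M. S (\<lambda>x. c * f x) \<omega> = sK c (S f \<omega>)) \<and>
     (\<exists>C. \<forall>f\<in>dual_space sX. Lp_norm M q (S f) \<le> C * onorm f)"

definition invertible_bounded_op_Lp_dual ::
    "('s::{real_normed_field, euclidean_space} \<Rightarrow> 'x::banach \<Rightarrow> 'x) \<Rightarrow>
     ('s \<Rightarrow> 'k::banach \<Rightarrow> 'k) \<Rightarrow> 'w measure \<Rightarrow> real \<Rightarrow> (('w \<Rightarrow> 'k) \<Rightarrow> ('x \<Rightarrow> 's)) \<Rightarrow> bool" where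
  "invertible_bounded_op_Lp_dual sX sK M q T \<longleftrightarrow>
     bounded_op_Lp_dual sX sK M q T \<and>
     (\<exists>S. bounded_op_dual_Lp sX sK M q S \<and>
        (\<forall>f\<in>dual_space sX. T (S f) = f) \<and>
        (\<forall>G\<in>Lp_space M q. AE \<omega> in M. S (T G) \<omega> = G \<omega>))"

end

theory Submission
  imports Defs
begin

text \<open>Write \<open>U x\<close> for the function \<open>\<omega> \<mapsto> \<Lambda> \<omega> x\<close> and \<open>T\<close> for the synthesis operator. Formally \<open>T\<close> is the adjoint of
the analysis operator \<open>U\<close> from \<open>X\<close> to \<open>L\<^sup>p\<close>, and the core of the theorem is that an injective operator
with an adjoint that is bounded below is an isomorphism, and so is its adjoint. The textbook proof
of this uses the duality of \<open>L\<^sup>p\<close> and \<open>L\<^sup>q\<close> for Hilbert space valued functions and the closed range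
theorem. The proof below replaces both by a variational argument. Its only input from duality is that the derivative of
\<open>R \<mapsto> \<integral> norm R powr p\<close> at \<open>R\<close> is, up to the factor \<open>p\<close>, the real part of the pairing with an explicit element \<open>R\<^sup>*\<close> of
\<open>L\<^sup>q\<close>, pointwise \<open>norm R powr (p - 2)\<close> times the Riesz dual of \<open>R\<close>, for which
\<open>norm R\<^sup>* = norm R powr (p - 1)\<close> in the norms of \<open>L\<^sup>q\<close> and \<open>L\<^sup>p\<close> (\<open>dual_element\<close>,
\<open>directional_derivative_lower_bound\<close>).

Upper bounds. If \<open>norm (T G) \<le> B * norm G\<close>, testing with \<open>(U x)\<^sup>*\<close>, cut off on sets of finite measure where
\<open>U x\<close> is bounded, shows that \<open>U x\<close> lies in \<open>L\<^sup>p\<close> with norm at most \<open>B * norm x\<close>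
(\<open>analysis_bounded\<close>). The Hoelder inequality gives the converse (\<open>synthesis_bounded\<close>). Hence the two
notions have the same upper bounds, and so the same optimal one.

Lower frame bound. Let \<open>A * norm G \<le> norm (T G)\<close> with \<open>A > \<epsilon> > 0\<close>, and let \<open>F\<close> be in \<open>L\<^sup>p\<close>. Ekeland's principle
for \<open>x \<mapsto> norm (F - U x)\<close>, started at 0, yields \<open>x\<close> with \<open>\<epsilon> * norm x \<le> norm F\<close> at which this function
decreases in no direction faster than \<open>\<epsilon>\<close>. If \<open>R = F - U x\<close> were not zero, the formula for the
derivative would give \<open>norm (T R\<^sup>*) \<le> \<epsilon> * norm R\<^sup>*\<close>, which contradicts the lower bound of \<open>T\<close>. So \<open>U x = F\<close>
(\<open>analysis_onto\<close>). With \<open>F = U y\<close> and injectivity, \<open>x = y\<close>, and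
the lower frame bound for \<open>y\<close> follows (\<open>analysis_bounded_below\<close>).

Surjectivity of \<open>T\<close>. For \<open>f\<close> in the dual of \<open>X\<close>, the lower frame bound makes
\<open>x \<mapsto> (1 / p) * \<integral> norm (U x) powr p - Re (f x)\<close> bounded below. At an approximate minimum in
the sense of Ekeland, \<open>T (U x)\<^sup>*\<close> is as close to \<open>f\<close> as desired (\<open>synthesis_dense_range\<close>); since \<open>T\<close> is
bounded below and \<open>L\<^sup>q\<close> is complete, \<open>f\<close> itself is attained (\<open>synthesis_onto\<close>).

In the other direction, an inverse of \<open>T\<close> gives the two Riesz bounds directly. If \<open>U x = 0\<close>, then every
functional in the range of \<open>T\<close>, hence every bounded functional, vanishes at \<open>x\<close>, and \<open>x = 0\<close> by the
Hahn-Banach theorem (\<open>dual_space_separates\<close>).\<close>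


section \<open>Bochner measurable functions\<close>

lemma measurable_completion_cong_AE:
  assumes f: "f \<in> measurable (completion M) N"
    and ae: "AE \<omega> in M. f \<omega> = g \<omega>"
    and g: "\<And>\<omega>. \<omega> \<in> space M \<Longrightarrow> g \<omega> \<in> space N"
  shows "g \<in> measurable (completion M) N"
proof (rule measurableI)
  show "\<And>\<omega>. \<omega> \<in> space (completion M) \<Longrightarrow> g \<omega> \<in> space N" using g by simp
next
  fix A assume A: "A \<in> sets N"
  have A': "f -` A \<inter> space (completion M) \<in> sets (completion M)"
    using f A by (rule measurable_sets)
  have "AE \<omega> in completion M. (\<omega> \<in> f -` A \<inter> space (completion M)) =
      (\<omega> \<in> g -` A \<inter> space (completion M))"
    using AE_completion[OF ae] by eventually_elim auto
  then show "g -` A \<inter> space (completion M) \<in> sets (completion M)"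
    by (rule completion.in_sets_AE[OF _ A']) auto
qed

lemma bochner_measurableE:
  assumes "bochner_measurable M f"
  obtains s :: "nat \<Rightarrow> 'a \<Rightarrow> 'b::banach" where "\<And>n. simple_function M (s n)"
    and "AE \<omega> in M. (\<lambda>n. norm (s n \<omega> - f \<omega>)) \<longlonglongrightarrow> 0"
proof -
  from assms[unfolded bochner_measurable_def] obtain s :: "nat \<Rightarrow> 'a \<Rightarrow> 'b"
    where "(\<forall>n. simple_function M (s n)) \<and> (AE \<omega> in M. (\<lambda>n. norm (s n \<omega> - f \<omega>)) \<longlonglongrightarrow> 0)" ..
  then show thesis using that[of s] by simp
qed

lemma bochner_measurableI:
  fixes f :: "'a \<Rightarrow> 'b::banach"
  assumes "\<And>n::nat. simple_function M (s n)"
    and "AE \<omega> in M. (\<lambda>n. norm (s n \<omega> - f \<omega>)) \<longlonglongrightarrow> 0"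
  shows "bochner_measurable M f"
  unfolding bochner_measurable_def using assms by (intro exI[of _ s]) simp

text \<open>The completion is essential: the limit of the simple functions is controlled only outside a null
set, and on that set the values of \<open>f\<close> are arbitrary.\<close>

lemma bochner_measurable_imp_borel:
  assumes "bochner_measurable M f"
  shows "f \<in> borel_measurable (completion M)"
proof -
  obtain s where s: "\<And>n. simple_function M (s n)"
    and lim: "AE \<omega> in M. (\<lambda>n. norm (s n \<omega> - f \<omega>)) \<longlonglongrightarrow> 0"
    by (rule bochner_measurableE[OF assms]) (rule that)
  obtain N where N: "\<And>\<omega>. \<omega> \<in> space M - N \<Longrightarrow> (\<lambda>n. norm (s n \<omega> - f \<omega>)) \<longlonglongrightarrow> 0"
      "N \<in> null_sets M"
    by (rule AE_E3[OF lim]) (rule that)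
  define f' where "f' \<omega> = (if \<omega> \<in> N then 0 else f \<omega>)" for \<omega>
  have N': "N \<in> sets M" using N(2) by auto
  have "f' \<in> borel_measurable M"
  proof (rule borel_measurable_LIMSEQ_metric)
    fix n
    have "simple_function M (\<lambda>\<omega>. if \<omega> \<in> N then 0 else s n \<omega>)"
      using s N' by (intro simple_function_If_set) (auto simp: Int_absorb2 sets.sets_into_space)
    then show "(\<lambda>\<omega>. if \<omega> \<in> N then 0 else s n \<omega>) \<in> borel_measurable M"
      by (rule borel_measurable_simple_function)
  next
    fix \<omega> assume "\<omega> \<in> space M"
    then show "(\<lambda>n. if \<omega> \<in> N then 0 else s n \<omega>) \<longlonglongrightarrow> f' \<omega>"
      using N(1)[of \<omega>] by (auto simp: f'_def LIM_zero_iff tendsto_norm_zero_iff)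
  qed
  then have "f' \<in> borel_measurable (completion M)" by (rule measurable_completion)
  moreover have "AE \<omega> in M. f' \<omega> = f \<omega>"
    using AE_not_in[OF N(2)] by eventually_elim (simp add: f'_def)
  ultimately show ?thesis by (rule measurable_completion_cong_AE) simp
qed

lemma bochner_measurable_simple: "simple_function M s \<Longrightarrow> bochner_measurable M s"
  by (rule bochner_measurableI[of _ "\<lambda>_. s"]) simp_all

text \<open>All arithmetic of Bochner measurable functions reduces to this: simple functions are stable under
arbitrary maps, and continuity carries the pointwise limit.\<close>

lemma bochner_measurable_continuous2:
  fixes h :: "'a::banach \<Rightarrow> 'b::banach \<Rightarrow> 'c::banach"
  assumes f: "bochner_measurable M f" and g: "bochner_measurable M g"
    and h: "continuous_on UNIV (\<lambda>z. h (fst z) (snd z))"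
  shows "bochner_measurable M (\<lambda>\<omega>. h (f \<omega>) (g \<omega>))"
proof -
  obtain s where s: "\<And>n. simple_function M (s n)"
    and slim: "AE \<omega> in M. (\<lambda>n. norm (s n \<omega> - f \<omega>)) \<longlonglongrightarrow> 0"
    by (rule bochner_measurableE[OF f]) (rule that)
  obtain t where t: "\<And>n. simple_function M (t n)"
    and tlim: "AE \<omega> in M. (\<lambda>n. norm (t n \<omega> - g \<omega>)) \<longlonglongrightarrow> 0"
    by (rule bochner_measurableE[OF g]) (rule that)
  have "AE \<omega> in M. (\<lambda>n. norm (h (s n \<omega>) (t n \<omega>) - h (f \<omega>) (g \<omega>))) \<longlonglongrightarrow> 0"
    using slim tlim
  proof eventually_elim
    case (elim \<omega>)
    have "(\<lambda>n. s n \<omega>) \<longlonglongrightarrow> f \<omega>" "(\<lambda>n. t n \<omega>) \<longlonglongrightarrow> g \<omega>"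
      using elim by (simp_all add: LIM_zero_iff tendsto_norm_zero_iff)
    then have "(\<lambda>n. (s n \<omega>, t n \<omega>)) \<longlonglongrightarrow> (f \<omega>, g \<omega>)" by (rule tendsto_Pair)
    moreover have "isCont (\<lambda>z. h (fst z) (snd z)) (f \<omega>, g \<omega>)"
      using h by (simp add: continuous_on_eq_continuous_at)
    ultimately have "(\<lambda>n. h (s n \<omega>) (t n \<omega>)) \<longlonglongrightarrow> h (f \<omega>) (g \<omega>)"
      using isCont_tendsto_compose by fastforce
    then show ?case by (simp add: LIM_zero_iff tendsto_norm_zero_iff)
  qed
  moreover have "simple_function M (\<lambda>\<omega>. h (s n \<omega>) (t n \<omega>))" for n
    using s t by (rule simple_function_compose2)
  ultimately show ?thesis by (intro bochner_measurableI)
qed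

lemma bochner_measurable_continuous:
  fixes h :: "'a::banach \<Rightarrow> 'c::banach"
  assumes f: "bochner_measurable M f" and h: "continuous_on UNIV h"
  shows "bochner_measurable M (\<lambda>\<omega>. h (f \<omega>))"
  using h by (intro bochner_measurable_continuous2[OF f f, of "\<lambda>a b. h a"])
    (auto intro!: continuous_on_compose2[OF h] continuous_intros)

lemma
  assumes "bochner_measurable M F" "bochner_measurable M G"
  shows bochner_measurable_add: "bochner_measurable M (\<lambda>\<omega>. F \<omega> + G \<omega>)"
    and bochner_measurable_diff: "bochner_measurable M (\<lambda>\<omega>. F \<omega> - G \<omega>)"
  by (auto intro!: bochner_measurable_continuous2[OF assms] continuous_intros)

lemma bochner_measurable_scaleR:
  "bochner_measurable M F \<Longrightarrow> bochner_measurable M (\<lambda>\<omega>. c *\<^sub>R F \<omega>)"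
  by (rule bochner_measurable_continuous) (auto intro!: continuous_intros)

text \<open>Cutting off a simple function has to be done along a set measurable for the measure itself, not
only for its completion; such sets are defined through this version of the norm.\<close>

lemma norm_measurable_version:
  assumes "bochner_measurable M f"
  obtains g :: "'a \<Rightarrow> real" where "g \<in> borel_measurable M" "AE \<omega> in M. norm (f \<omega>) = g \<omega>"
  using completion_ex_borel_measurable_real[OF measurable_compose[OF
      bochner_measurable_imp_borel[OF assms] borel_measurable_norm]] that by blast


section \<open>Bochner spaces\<close>

definition power_integral :: "'w measure \<Rightarrow> real \<Rightarrow> ('w \<Rightarrow> 'k::banach) \<Rightarrow> real" where
  "power_integral M r F = (\<integral>\<omega>. norm (F \<omega>) powr r \<partial>completion M)"

lemma power_integral_nonneg: "0 \<le> power_integral M r F"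
  unfolding power_integral_def by simp

text \<open>This replaces the nonnegative integral by a Bochner integral, which makes linearity and
dominated convergence available.\<close>

lemma Lp_space_iff:
  "F \<in> Lp_space M r \<longleftrightarrow>
     bochner_measurable M F \<and> integrable (completion M) (\<lambda>\<omega>. norm (F \<omega>) powr r)"
  using bochner_measurable_imp_borel[of M F]
  by (auto simp: Lp_space_def Lp_finite_def integrable_iff_bounded)

lemma Lp_norm_eq:
  assumes "F \<in> Lp_space M r"
  shows "Lp_norm M r F = power_integral M r F powr (1 / r)"
  using assms unfolding Lp_space_iff Lp_norm_def power_integral_def
  by (simp add: integral_eq_nn_integral borel_measurable_integrable)

lemma Lp_norm_nonneg: "0 \<le> Lp_norm M r F"
  unfolding Lp_norm_def by simp

lemma Lp_norm_powr:
  assumes "F \<in> Lp_space M r" "0 < r"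
  shows "Lp_norm M r F powr r = power_integral M r F"
  using assms power_integral_nonneg[of M r F] by (simp add: Lp_norm_eq powr_powr)

lemma Lp_norm_le_iff:
  assumes "F \<in> Lp_space M r" "0 < r" "0 \<le> c"
  shows "Lp_norm M r F \<le> c \<longleftrightarrow> power_integral M r F \<le> c powr r"
  using assms Lp_norm_nonneg[of M r F]
  by (metis Lp_norm_powr linorder_not_le powr_less_mono2 powr_mono2 less_imp_le)

lemma Lp_norm_cong_AE:
  assumes "AE \<omega> in M. F \<omega> = G \<omega>"
  shows "Lp_norm M r F = Lp_norm M r G"
proof -
  have "(\<integral>\<^sup>+\<omega>. ennreal (norm (F \<omega>) powr r) \<partial>completion M) =
      (\<integral>\<^sup>+\<omega>. ennreal (norm (G \<omega>) powr r) \<partial>completion M)"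
    using AE_completion[OF assms] by (intro nn_integral_cong_AE) (auto elim: eventually_mono)
  then show ?thesis by (simp add: Lp_norm_def)
qed

lemma Lp_norm_eq_0:
  assumes "F \<in> Lp_space M r" "Lp_norm M r F = 0"
  shows "AE \<omega> in M. F \<omega> = 0"
proof -
  have "power_integral M r F = 0" using assms by (simp add: Lp_norm_eq)
  then have "AE \<omega> in completion M. norm (F \<omega>) powr r = 0"
    using assms(1) unfolding Lp_space_iff power_integral_def
    by (simp add: integral_nonneg_eq_0_iff_AE)
  then show ?thesis by (simp add: AE_completion_iff)
qed

lemma powr_add_le:
  fixes a b r :: real
  assumes "0 \<le> a" "0 \<le> b" "0 \<le> r"
  shows "(a + b) powr r \<le> 2 powr r * (a powr r + b powr r)"
proof -
  have "(a + b) powr r \<le> (2 * max a b) powr r" using assms by (intro powr_mono2) auto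
  also have "\<dots> = 2 powr r * max a b powr r" using assms by (simp add: powr_mult)
  also have "\<dots> \<le> 2 powr r * (a powr r + b powr r)"
    by (intro mult_left_mono) (auto simp: max_def)
  finally show ?thesis .
qed

lemma Lp_spaceI_bound:
  assumes "bochner_measurable M F" "F1 \<in> Lp_space M r" "F2 \<in> Lp_space M r" "0 \<le> r"
    and "AE \<omega> in M. norm (F \<omega>) \<le> c * (norm (F1 \<omega>) + norm (F2 \<omega>))" "0 \<le> c"
  shows "F \<in> Lp_space M r"
proof -
  have m: "(\<lambda>\<omega>. norm (F \<omega>) powr r) \<in> borel_measurable (completion M)"
    using bochner_measurable_imp_borel[OF assms(1)] by measurable
  have "integrable (completion M)
      (\<lambda>\<omega>. c powr r * (2 powr r * (norm (F1 \<omega>) powr r + norm (F2 \<omega>) powr r)))"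
    using assms(2,3) unfolding Lp_space_iff by auto
  then have "integrable (completion M) (\<lambda>\<omega>. norm (F \<omega>) powr r)"
  proof (rule Bochner_Integration.integrable_bound[OF _ m])
    show "AE \<omega> in completion M. norm (norm (F \<omega>) powr r) \<le>
        norm (c powr r * (2 powr r * (norm (F1 \<omega>) powr r + norm (F2 \<omega>) powr r)))"
      using AE_completion[OF assms(5)]
    proof eventually_elim
      case (elim \<omega>)
      have "norm (F \<omega>) powr r \<le> (c * (norm (F1 \<omega>) + norm (F2 \<omega>))) powr r"
        using elim assms by (intro powr_mono2) auto
      also have "\<dots> \<le> c powr r * (2 powr r * (norm (F1 \<omega>) powr r + norm (F2 \<omega>) powr r))"
        using assms by (simp add: powr_mult mult_left_mono powr_add_le)
      finally show ?case by (simp)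
    qed
  qed
  with assms(1) show ?thesis by (simp add: Lp_space_iff)
qed

lemma
  assumes "F \<in> Lp_space M r" "G \<in> Lp_space M r" "0 \<le> r"
  shows Lp_space_add: "(\<lambda>\<omega>. F \<omega> + G \<omega>) \<in> Lp_space M r"
    and Lp_space_diff: "(\<lambda>\<omega>. F \<omega> - G \<omega>) \<in> Lp_space M r"
proof -
  have bm: "bochner_measurable M F" "bochner_measurable M G" using assms by (auto simp: Lp_space_iff)
  show "(\<lambda>\<omega>. F \<omega> + G \<omega>) \<in> Lp_space M r"
    by (rule Lp_spaceI_bound[where c=1, OF bochner_measurable_add[OF bm] assms])
      (simp_all add: norm_triangle_ineq)
  show "(\<lambda>\<omega>. F \<omega> - G \<omega>) \<in> Lp_space M r"
    by (rule Lp_spaceI_bound[where c=1, OF bochner_measurable_diff[OF bm] assms])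
      (simp_all add: norm_triangle_ineq4)
qed

lemma Lp_space_scaleR:
  assumes "F \<in> Lp_space M r" "0 \<le> r"
  shows "(\<lambda>\<omega>. c *\<^sub>R F \<omega>) \<in> Lp_space M r"
  using assms(1) by (intro Lp_spaceI_bound[OF _ assms(1) assms(1) assms(2), where c="\<bar>c\<bar>"])
    (auto intro!: bochner_measurable_scaleR simp: Lp_space_iff mult_left_mono)

lemma Lp_norm_minus_commute: "Lp_norm M r (\<lambda>\<omega>. F \<omega> - G \<omega>) = Lp_norm M r (\<lambda>\<omega>. G \<omega> - F \<omega>)"
  unfolding Lp_norm_def by (simp add: norm_minus_commute)

text \<open>Approximating simple functions become dominated by \<open>2 * norm G\<close> when they are set to 0 wherever they exceed
this bound. The cut-off does not disturb the pointwise limit: where \<open>G\<close> is not zero it is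
eventually inactive, and where \<open>G\<close> is zero it produces 0.\<close>

lemma simple_dense_Lp:
  assumes G: "G \<in> Lp_space M r" and r: "0 < r" and e: "0 < e"
  obtains s where "simple_function M s" "s \<in> Lp_space M r" "Lp_norm M r (\<lambda>\<omega>. G \<omega> - s \<omega>) \<le> e"
proof -
  have bm: "bochner_measurable M G" and int: "integrable (completion M) (\<lambda>\<omega>. norm (G \<omega>) powr r)"
    using G by (auto simp: Lp_space_iff)
  obtain s where s: "\<And>n. simple_function M (s n)"
    and lim: "AE \<omega> in M. (\<lambda>n. norm (s n \<omega> - G \<omega>)) \<longlonglongrightarrow> 0"
    by (rule bochner_measurableE[OF bm]) (rule that)
  obtain g where g: "g \<in> borel_measurable M" "AE \<omega> in M. norm (G \<omega>) = g \<omega>"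
    using norm_measurable_version[OF bm] .
  \<comment> \<open>The factor 2 leaves room: where \<open>G\<close> is not zero, \<open>norm (s n)\<close> is eventually less than \<open>2 * norm G\<close>.\<close>
  define t where "t n \<omega> = (if norm (s n \<omega>) \<le> 2 * g \<omega> then s n \<omega> else 0)" for n \<omega>
  have t: "simple_function M (t n)" for n
  proof -
    have [measurable]: "(\<lambda>\<omega>. norm (s n \<omega>)) \<in> borel_measurable M"
      using measurable_compose[OF borel_measurable_simple_function[OF s[of n]] borel_measurable_norm] .
    note [measurable] = g(1)
    have "{\<omega>\<in>space M. norm (s n \<omega>) \<le> 2 * g \<omega>} \<in> sets M" by measurable
    then show ?thesis unfolding t_def using s by (intro simple_function_If) auto
  qed
  have bound: "AE \<omega> in M. norm (t n \<omega>) \<le> 1 * (norm (G \<omega>) + norm (G \<omega>))" for n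
    using g(2) by eventually_elim (smt (verit) norm_ge_zero norm_zero t_def)
  have tL: "t n \<in> Lp_space M r" for n
    by (rule Lp_spaceI_bound[OF bochner_measurable_simple[OF t] G G _ bound]) (use r in auto)
  have tlim: "AE \<omega> in M. (\<lambda>n. norm (G \<omega> - t n \<omega>)) \<longlonglongrightarrow> 0"
    using lim g(2)
  proof eventually_elim
    case (elim \<omega>)
    have sl: "(\<lambda>n. s n \<omega>) \<longlonglongrightarrow> G \<omega>"
      using elim by (simp add: LIM_zero_iff tendsto_norm_zero_iff)
    have "(\<lambda>n. t n \<omega>) \<longlonglongrightarrow> G \<omega>"
    proof (cases "G \<omega> = 0")
      case True
      then have "t n \<omega> = 0" for n using elim by (auto simp: t_def)
      with True show ?thesis by simp
    next
      case False
      have "(\<lambda>n. norm (s n \<omega>)) \<longlonglongrightarrow> norm (G \<omega>)" using sl by (rule tendsto_norm)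
      then have "\<forall>\<^sub>F n in sequentially. norm (s n \<omega>) < 2 * norm (G \<omega>)"
        by (rule order_tendstoD) (use False in auto)
      then have "\<forall>\<^sub>F n in sequentially. s n \<omega> = t n \<omega>"
        by eventually_elim (use elim in \<open>auto simp: t_def\<close>)
      with sl show ?thesis by (rule Lim_transform_eventually)
    qed
    then have "(\<lambda>n. G \<omega> - t n \<omega>) \<longlonglongrightarrow> G \<omega> - G \<omega>" by (intro tendsto_intros)
    then show ?case by (simp add: tendsto_norm_zero_iff)
  qed
  have "(\<lambda>n. power_integral M r (\<lambda>\<omega>. G \<omega> - t n \<omega>)) \<longlonglongrightarrow> (\<integral>\<omega>. 0 \<partial>completion M)"
    unfolding power_integral_def
  proof (rule integral_dominated_convergence[where w="\<lambda>\<omega>. 3 powr r * norm (G \<omega>) powr r"])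
    show "(\<lambda>\<omega>. norm (G \<omega> - t n \<omega>) powr r) \<in> borel_measurable (completion M)" for n
      using Lp_space_diff[OF G tL, of n] r by (auto simp: Lp_space_iff)
    show "AE \<omega> in completion M. (\<lambda>n. norm (G \<omega> - t n \<omega>) powr r) \<longlonglongrightarrow> 0"
      using AE_completion[OF tlim]
    proof eventually_elim
      case (elim \<omega>)
      have "(\<lambda>n. norm (G \<omega> - t n \<omega>) powr r) \<longlonglongrightarrow> 0 powr r"
        by (rule tendsto_powr2) (use elim r in auto)
      then show ?case by simp
    qed
    show "AE \<omega> in completion M. norm (norm (G \<omega> - t n \<omega>) powr r) \<le> 3 powr r * norm (G \<omega>) powr r" for n
      using AE_completion[OF bound[of n]]
    proof eventually_elim
      case (elim \<omega>)
      have "norm (G \<omega> - t n \<omega>) \<le> 3 * norm (G \<omega>)"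
        using elim norm_triangle_ineq4[of "G \<omega>" "t n \<omega>"] by simp
      then have "norm (G \<omega> - t n \<omega>) powr r \<le> (3 * norm (G \<omega>)) powr r"
        using r by (intro powr_mono2) auto
      then show ?case by (simp add: powr_mult)
    qed
  qed (use int in auto)
  then have "(\<lambda>n. power_integral M r (\<lambda>\<omega>. G \<omega> - t n \<omega>)) \<longlonglongrightarrow> 0" by simp
  then have "\<forall>\<^sub>F n in sequentially. power_integral M r (\<lambda>\<omega>. G \<omega> - t n \<omega>) < e powr r"
    by (rule order_tendstoD) (use e in auto)
  then obtain n where "power_integral M r (\<lambda>\<omega>. G \<omega> - t n \<omega>) < e powr r"
    by (auto simp: eventually_sequentially)
  then have "Lp_norm M r (\<lambda>\<omega>. G \<omega> - t n \<omega>) \<le> e"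
    using Lp_space_diff[OF G tL] r e by (subst Lp_norm_le_iff) auto
  with t tL show thesis using that by blast
qed

text \<open>The completeness of the Bochner space, in the form needed later. Because the sequence consists of simple
functions, its pointwise limit is Bochner measurable by definition. Summability of the integrals of
\<open>(2 ^ n * norm (s (n + 1) - s n)) powr r\<close> forces the increments below \<open>(1/2) ^ n\<close> eventually, almost everywhere, and
the Fatou lemma transfers the bounds to the limit.\<close>

lemma Lp_complete_simple:
  fixes s :: "nat \<Rightarrow> 'w \<Rightarrow> 'k::banach"
  assumes s: "\<And>n. simple_function M (s n)" and sL: "\<And>n. s n \<in> Lp_space M r" and r: "0 < r"
    and fast: "\<And>m n. n \<le> m \<Longrightarrow> Lp_norm M r (\<lambda>\<omega>. s m \<omega> - s n \<omega>) \<le> (1/4) ^ n"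
  obtains G where "G \<in> Lp_space M r" "\<And>n. Lp_norm M r (\<lambda>\<omega>. G \<omega> - s n \<omega>) \<le> (1/4) ^ n"
proof -
  let ?C = "completion M"
  have dL: "(\<lambda>\<omega>. s m \<omega> - s n \<omega>) \<in> Lp_space M r" for m n
    using Lp_space_diff[OF sL sL] r by simp
  have dm: "(\<lambda>\<omega>. norm (s m \<omega> - s n \<omega>) powr r) \<in> borel_measurable ?C" for m n
    using dL by (auto simp: Lp_space_iff)
  have d_le: "(\<integral>\<^sup>+\<omega>. ennreal (norm (s m \<omega> - s n \<omega>) powr r) \<partial>?C) \<le> ennreal (((1/4) ^ n) powr r)"
    if "n \<le> m" for m n
  proof -
    have "power_integral M r (\<lambda>\<omega>. s m \<omega> - s n \<omega>) \<le> ((1/4) ^ n) powr r"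
      using fast[OF that] dL r by (subst (asm) Lp_norm_le_iff) auto
    then show ?thesis using dL[of m n] unfolding power_integral_def Lp_space_iff
      by (subst nn_integral_eq_integral) (auto intro: ennreal_leI)
  qed
  \<comment> \<open>The weight \<open>2 ^ n\<close> lies between 1 and the rate \<open>4 ^ n\<close>: the integrals still sum, and boundedness of \<open>d n\<close> already makes the increments summable.\<close>
  define d where "d n \<omega> = ((2 ^ n * norm (s (Suc n) \<omega> - s n \<omega>)) powr r)" for n \<omega>
  have d_eq: "d n \<omega> = (2 ^ n) powr r * norm (s (Suc n) \<omega> - s n \<omega>) powr r" for n \<omega>
    by (simp add: d_def powr_mult)
  have d_meas[measurable]: "d n \<in> borel_measurable ?C" for n
    unfolding d_eq[abs_def] using dm[of "Suc n" n] by simp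
  have "(\<integral>\<^sup>+\<omega>. (\<Sum>n. ennreal (d n \<omega>)) \<partial>?C) = (\<Sum>n. \<integral>\<^sup>+\<omega>. ennreal (d n \<omega>) \<partial>?C)"
    by (rule nn_integral_suminf) measurable
  also have "\<dots> \<le> (\<Sum>n. ennreal (((1/2) powr r) ^ n))"
  proof (intro suminf_le summableI)
    fix n
    have "(\<integral>\<^sup>+\<omega>. ennreal (d n \<omega>) \<partial>?C) =
        ennreal ((2 ^ n) powr r) * (\<integral>\<^sup>+\<omega>. ennreal (norm (s (Suc n) \<omega> - s n \<omega>) powr r) \<partial>?C)"
      unfolding d_eq using dm[of "Suc n" n] by (simp add: ennreal_mult nn_integral_cmult)
    also have "\<dots> \<le> ennreal ((2 ^ n) powr r) * ennreal (((1/4) ^ n) powr r)"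
      by (intro mult_left_mono d_le) auto
    also have "\<dots> = ennreal ((2 ^ n * (1/4) ^ n) powr r)"
      by (simp add: ennreal_mult[symmetric] powr_mult)
    also have "(2 ^ n * (1/4) ^ n) powr r = ((1/2::real) ^ n) powr r"
      by (simp add: power_mult_distrib[symmetric])
    also have "\<dots> = ((1/2) powr r) ^ n"
      by (simp add: powr_powr powr_realpow[symmetric] mult.commute)
    finally show "(\<integral>\<^sup>+\<omega>. ennreal (d n \<omega>) \<partial>?C) \<le> ennreal (((1/2) powr r) ^ n)" .
  qed
  also have "\<dots> < \<infinity>"
  proof -
    have "(1/2::real) powr r < 1" using powr_less_mono2[OF r, of "1/2" 1] by simp
    then have "summable (\<lambda>n. ((1/2::real) powr r) ^ n)" by (intro summable_geometric) auto
    then show ?thesis by (simp add: suminf_ennreal2 less_top[symmetric])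
  qed
  finally have "AE \<omega> in ?C. (\<Sum>n. ennreal (d n \<omega>)) \<noteq> \<infinity>"
    by (intro nn_integral_noteq_infinite) (auto simp: less_top)
  then have conv: "AE \<omega> in ?C. convergent (\<lambda>n. s n \<omega>)"
  proof eventually_elim
    case (elim \<omega>)
    have "summable (\<lambda>n. d n \<omega>)"
      using elim by (intro summable_suminf_not_top) (auto simp: d_def)
    then have "(\<lambda>n. d n \<omega>) \<longlonglongrightarrow> 0" by (rule summable_LIMSEQ_zero)
    then have "\<forall>\<^sub>F n in sequentially. d n \<omega> < 1" by (rule order_tendstoD) simp
    then have "\<forall>\<^sub>F n in sequentially. norm (s (Suc n) \<omega> - s n \<omega>) \<le> (1/2) ^ n"
    proof eventually_elim
      case (elim n)
      have "2 ^ n * norm (s (Suc n) \<omega> - s n \<omega>) < 1"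
        using elim r ge_one_powr_ge_zero[of "2 ^ n * norm (s (Suc n) \<omega> - s n \<omega>)" r]
        unfolding d_def by linarith
      then show ?case by (simp add: power_divide field_simps)
    qed
    then have "summable (\<lambda>n. s (Suc n) \<omega> - s n \<omega>)"
      by (rule summable_comparison_test_ev) (intro summable_geometric, simp)
    then have "convergent (\<lambda>m. \<Sum>n<m. s (Suc n) \<omega> - s n \<omega>)"
      by (simp add: summable_iff_convergent)
    then have "convergent (\<lambda>m. (\<Sum>n<m. s (Suc n) \<omega> - s n \<omega>) + s 0 \<omega>)"
      by (rule convergent_add[OF _ convergent_const])
    then show ?case unfolding sum_lessThan_telescope[of "\<lambda>n. s n \<omega>"] by simp
  qed
  define G where "G \<omega> = lim (\<lambda>n. s n \<omega>)" for \<omega>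
  have lim: "AE \<omega> in ?C. (\<lambda>n. s n \<omega>) \<longlonglongrightarrow> G \<omega>"
    using conv by eventually_elim (simp add: G_def convergent_LIMSEQ_iff)
  have bmG: "bochner_measurable M G"
  proof (rule bochner_measurableI)
    show "AE \<omega> in M. (\<lambda>n. norm (s n \<omega> - G \<omega>)) \<longlonglongrightarrow> 0"
      using lim by (simp add: AE_completion_iff LIM_zero_iff tendsto_norm_zero_iff)
  qed (rule s)
  have fatou: "(\<integral>\<^sup>+\<omega>. ennreal (norm (G \<omega> - s n \<omega>) powr r) \<partial>?C) \<le> ennreal (((1/4) ^ n) powr r)" for n
  proof -
    have "(\<integral>\<^sup>+\<omega>. ennreal (norm (G \<omega> - s n \<omega>) powr r) \<partial>?C) =
        (\<integral>\<^sup>+\<omega>. liminf (\<lambda>m. ennreal (norm (s m \<omega> - s n \<omega>) powr r)) \<partial>?C)"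
    proof (intro nn_integral_cong_AE)
      show "AE \<omega> in ?C. ennreal (norm (G \<omega> - s n \<omega>) powr r) =
          liminf (\<lambda>m. ennreal (norm (s m \<omega> - s n \<omega>) powr r))"
        using lim
      proof eventually_elim
        case (elim \<omega>)
        have "(\<lambda>m. norm (s m \<omega> - s n \<omega>) powr r) \<longlonglongrightarrow> norm (G \<omega> - s n \<omega>) powr r"
          by (rule tendsto_powr2) (use elim r in \<open>auto intro!: tendsto_intros\<close>)
        then have "(\<lambda>m. ennreal (norm (s m \<omega> - s n \<omega>) powr r)) \<longlonglongrightarrow> ennreal (norm (G \<omega> - s n \<omega>) powr r)"
          by (rule tendsto_ennrealI)
        then show ?case by (rule lim_imp_Liminf[OF sequentially_bot, symmetric])
      qed
    qed
    also have "\<dots> \<le> liminf (\<lambda>m. \<integral>\<^sup>+\<omega>. ennreal (norm (s m \<omega> - s n \<omega>) powr r) \<partial>?C)"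
      using dm by (intro nn_integral_liminf) simp
    also have "\<dots> \<le> liminf (\<lambda>m::nat. ennreal (((1/4) ^ n) powr r))"
      by (intro Liminf_mono) (use d_le in \<open>auto simp: eventually_sequentially\<close>)
    also have "\<dots> = ennreal (((1/4) ^ n) powr r)" by (simp add: Liminf_const)
    finally show ?thesis .
  qed
  have GsL: "(\<lambda>\<omega>. G \<omega> - s n \<omega>) \<in> Lp_space M r" for n
    using fatou[of n] bochner_measurable_diff[OF bmG bochner_measurable_simple[OF s]]
    by (auto simp: Lp_space_def Lp_finite_def intro: le_less_trans)
  show thesis
  proof
    show "G \<in> Lp_space M r" using Lp_space_add[OF GsL[of 0] sL[of 0]] r by simp
    fix n
    have "power_integral M r (\<lambda>\<omega>. G \<omega> - s n \<omega>) \<le> ((1/4) ^ n) powr r"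
      using fatou[of n] GsL[of n] unfolding power_integral_def Lp_space_iff
      by (subst (asm) nn_integral_eq_integral) auto
    then show "Lp_norm M r (\<lambda>\<omega>. G \<omega> - s n \<omega>) \<le> (1/4) ^ n"
      using GsL r by (subst Lp_norm_le_iff) auto
  qed
qed

text \<open>The Young inequality integrated after dividing both functions by their norms; if one norm is 0, the
product vanishes almost everywhere.\<close>

lemma holder_Lp:
  fixes F :: "'w \<Rightarrow> 'a::banach" and G :: "'w \<Rightarrow> 'b::banach"
  assumes pq: "1 < p" "1 < q" "1 / p + 1 / q = 1"
    and F: "F \<in> Lp_space M p" and G: "G \<in> Lp_space M q"
  shows "integrable (completion M) (\<lambda>\<omega>. norm (F \<omega>) * norm (G \<omega>))"
    and "(\<integral>\<omega>. norm (F \<omega>) * norm (G \<omega>) \<partial>completion M) \<le> Lp_norm M p F * Lp_norm M q G"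
proof -
  let ?C = "completion M"
  have iF: "integrable ?C (\<lambda>\<omega>. norm (F \<omega>) powr p)" and iG: "integrable ?C (\<lambda>\<omega>. norm (G \<omega>) powr q)"
    using F G by (auto simp: Lp_space_iff)
  have [measurable]: "F \<in> borel_measurable ?C" "G \<in> borel_measurable ?C"
    using F G by (auto simp: Lp_space_iff intro: bochner_measurable_imp_borel)
  have meas: "(\<lambda>\<omega>. norm (F \<omega>) * norm (G \<omega>)) \<in> borel_measurable ?C" by measurable
  show int: "integrable ?C (\<lambda>\<omega>. norm (F \<omega>) * norm (G \<omega>))"
  proof (rule Bochner_Integration.integrable_bound[OF _ meas])
    show "integrable ?C (\<lambda>\<omega>. norm (F \<omega>) powr p / p + norm (G \<omega>) powr q / q)" using iF iG by auto
    show "AE \<omega> in ?C. norm (norm (F \<omega>) * norm (G \<omega>)) \<le> norm (norm (F \<omega>) powr p / p + norm (G \<omega>) powr q / q)"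
      using Youngs_inequality[OF pq] pq by (intro AE_I2) simp
  qed
  define a b where "a = Lp_norm M p F" and "b = Lp_norm M q G"
  have ab: "0 \<le> a" "0 \<le> b" by (simp_all add: a_def b_def Lp_norm_nonneg)
  show "(\<integral>\<omega>. norm (F \<omega>) * norm (G \<omega>) \<partial>?C) \<le> Lp_norm M p F * Lp_norm M q G"
  proof (cases "a = 0 \<or> b = 0")
    case True
    have "AE \<omega> in M. norm (F \<omega>) * norm (G \<omega>) = 0"
    proof (cases "a = 0")
      case True
      show ?thesis using Lp_norm_eq_0[OF F True[unfolded a_def]] by eventually_elim simp
    next
      case False
      then have "Lp_norm M q G = 0" using \<open>a = 0 \<or> b = 0\<close> by (simp add: b_def)
      from Lp_norm_eq_0[OF G this] show ?thesis by eventually_elim simp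
    qed
    then have "(\<integral>\<omega>. norm (F \<omega>) * norm (G \<omega>) \<partial>?C) = (\<integral>\<omega>. 0 \<partial>?C)"
      using meas by (intro integral_cong_AE) (auto simp: AE_completion)
    then show ?thesis using ab by (simp add: a_def b_def)
  next
    case False
    then have pos: "0 < a" "0 < b" using ab by auto
    have "(\<integral>\<omega>. norm (F \<omega>) * norm (G \<omega>) \<partial>?C) =
        a * b * (\<integral>\<omega>. (norm (F \<omega>) / a) * (norm (G \<omega>) / b) \<partial>?C)"
      using pos by simp
    also have "\<dots> \<le> a * b * (\<integral>\<omega>. norm (F \<omega>) powr p * (1 / (a powr p * p))
        + norm (G \<omega>) powr q * (1 / (b powr q * q)) \<partial>?C)"
    proof (intro mult_left_mono integral_mono)
      show "integrable ?C (\<lambda>\<omega>. norm (F \<omega>) / a * (norm (G \<omega>) / b))" using int by simp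
      show "integrable ?C (\<lambda>\<omega>. norm (F \<omega>) powr p * (1 / (a powr p * p)) + norm (G \<omega>) powr q * (1 / (b powr q * q)))"
        using iF iG by (intro Bochner_Integration.integrable_add integrable_mult_left) auto
      show "norm (F \<omega>) / a * (norm (G \<omega>) / b) \<le>
          norm (F \<omega>) powr p * (1 / (a powr p * p)) + norm (G \<omega>) powr q * (1 / (b powr q * q))" for \<omega>
        using Youngs_inequality[OF pq, of "norm (F \<omega>) / a" "norm (G \<omega>) / b"] pos by (simp add: powr_divide)
    qed (use pos in auto)
    also have "(\<integral>\<omega>. norm (F \<omega>) powr p * (1 / (a powr p * p)) + norm (G \<omega>) powr q * (1 / (b powr q * q)) \<partial>?C)
        = power_integral M p F * (1 / (a powr p * p)) + power_integral M q G * (1 / (b powr q * q))"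
      using iF iG unfolding power_integral_def
      by (subst Bochner_Integration.integral_add) (auto intro!: integrable_mult_left simp del: times_divide_eq_right)
    also have "power_integral M p F = a powr p" using Lp_norm_powr[OF F] pq by (simp add: a_def)
    also have "power_integral M q G = b powr q" using Lp_norm_powr[OF G] pq by (simp add: b_def)
    also have "a powr p * (1 / (a powr p * p)) + b powr q * (1 / (b powr q * q)) = 1"
      using pos pq by simp
    finally show ?thesis by (simp add: a_def b_def)
  qed
qed


section \<open>Bounded functionals separate points\<close>

text \<open>For positive factors the inequality in the second clause already implies equality, and also that the value
at 0 is 0. The weaker form is easier to verify for infima.\<close>

definition sublinear_functional :: "('x::real_vector \<Rightarrow> real) \<Rightarrow> bool" where
  "sublinear_functional q \<longleftrightarrow>
     (\<forall>x y. q (x + y) \<le> q x + q y) \<and> (\<forall>t>0. \<forall>x. q (t *\<^sub>R x) \<le> t * q x)"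

lemma sublinear_functional_scale:
  assumes "sublinear_functional q" "0 \<le> t"
  shows "q (t *\<^sub>R x) = t * q x"
proof -
  have *: "q (s *\<^sub>R y) \<le> s * q y" if "0 < s" for s y
    using assms(1) that unfolding sublinear_functional_def by blast
  show ?thesis
  proof (cases "t = 0")
    case True
    have "q (2 *\<^sub>R 0) \<le> 2 * q 0" "q ((1/2) *\<^sub>R 0) \<le> (1/2) * q 0" by (rule *, simp)+
    with True show ?thesis by simp
  next
    case False
    then have t: "0 < t" using assms by simp
    have "q ((1/t) *\<^sub>R (t *\<^sub>R x)) \<le> (1/t) * q (t *\<^sub>R x)" using t by (intro *) simp
    then have "t * q x \<le> q (t *\<^sub>R x)" using t by (simp add: field_simps)
    with *[OF t, of x] show ?thesis by simp
  qed
qed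

lemma sublinear_functional_lower:
  assumes "sublinear_functional q"
  shows "- q (- x) \<le> q x"
proof -
  have "q (x + - x) \<le> q x + q (- x)"
    using assms unfolding sublinear_functional_def by blast
  then show ?thesis using sublinear_functional_scale[OF assms, of 0] by simp
qed

text \<open>The functional is \<open>q' x = (INF t\<in>{0..}. q (x + t y) - t * q y)\<close>. It is used twice: it shows that
minimal sublinear functionals are additive, and applied to the norm it prescribes the value of a
functional at a point.\<close>

lemma sublinear_functional_shrink:
  fixes q :: "'x::real_vector \<Rightarrow> real"
  assumes q: "sublinear_functional q"
  obtains q' where "sublinear_functional q'" "\<And>x. q' x \<le> q x" "\<And>x. q' x \<le> q (x + y) - q y"
proof -
  have sub: "q (u + v) \<le> q u + q v" for u v
    using q unfolding sublinear_functional_def by blast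
  note sc = sublinear_functional_scale[OF q]
  define S where "S x = (\<lambda>t. q (x + t *\<^sub>R y) - t * q y) ` {0..}" for x
  define q' where "q' x = Inf (S x)" for x
  have bdd: "bdd_below (S x)" for x
  proof (rule bdd_belowI[of _ "- q (- x)"])
    fix v assume "v \<in> S x"
    then obtain t where t: "0 \<le> t" "v = q (x + t *\<^sub>R y) - t * q y" unfolding S_def by auto
    have "q (t *\<^sub>R y) \<le> q (x + t *\<^sub>R y) + q (- x)" using sub[of "x + t *\<^sub>R y" "- x"] by simp
    then show "- q (- x) \<le> v" using t sc[of t y] by simp
  qed
  have lower: "q' x \<le> q (x + t *\<^sub>R y) - t * q y" if "0 \<le> t" for x t
    unfolding q'_def by (rule cInf_lower[OF _ bdd]) (use that in \<open>auto simp: S_def\<close>)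
  have approx: "\<exists>t\<ge>0. q (x + t *\<^sub>R y) - t * q y < q' x + e" if "0 < e" for x e
  proof -
    have "\<exists>v\<in>S x. v < q' x + e"
      unfolding q'_def by (rule cInf_lessD) (use that in \<open>auto simp: S_def\<close>)
    then show ?thesis unfolding S_def by auto
  qed
  have "sublinear_functional q'"
    unfolding sublinear_functional_def
  proof (intro conjI allI impI)
    fix u v
    show "q' (u + v) \<le> q' u + q' v"
    proof (rule field_le_epsilon)
      fix e :: real assume "0 < e"
      then obtain s t where s: "0 \<le> s" "q (u + s *\<^sub>R y) - s * q y < q' u + e/2"
        and t: "0 \<le> t" "q (v + t *\<^sub>R y) - t * q y < q' v + e/2"
        using approx[of "e/2" u] approx[of "e/2" v] by auto
      have "q' (u + v) \<le> q ((u + s *\<^sub>R y) + (v + t *\<^sub>R y)) - (s + t) * q y"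
        using lower[of "s + t" "u + v"] s(1) t(1) by (simp add: algebra_simps)
      also have "\<dots> \<le> q (u + s *\<^sub>R y) + q (v + t *\<^sub>R y) - (s + t) * q y" using sub by simp
      finally show "q' (u + v) \<le> q' u + q' v + e" using s t by (simp add: algebra_simps)
    qed
  next
    fix c :: real and x assume c: "0 < c"
    show "q' (c *\<^sub>R x) \<le> c * q' x"
    proof (rule field_le_epsilon)
      fix e :: real assume "0 < e"
      then obtain t where t: "0 \<le> t" "q (x + t *\<^sub>R y) - t * q y < q' x + e / c"
        using approx[of "e / c" x] c by auto
      have "q' (c *\<^sub>R x) \<le> q (c *\<^sub>R (x + t *\<^sub>R y)) - (c * t) * q y"
        using lower[of "c * t" "c *\<^sub>R x"] t(1) c by (simp add: algebra_simps)
      also have "\<dots> = c * (q (x + t *\<^sub>R y) - t * q y)" using sc[of c "x + t *\<^sub>R y"] c by (simp add: right_diff_distrib mult.assoc)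
      also have "\<dots> \<le> c * (q' x + e / c)" using t(2) c by (intro mult_left_mono) auto
      also have "\<dots> = c * q' x + e" using c by (simp add: field_simps)
      finally show "q' (c *\<^sub>R x) \<le> c * q' x + e" .
    qed
  qed
  then show thesis using lower[of 0] lower[of 1] by (intro that[of q']) auto
qed

lemma Inf_chain_sublinear_functional:
  fixes C :: "('x::real_vector \<Rightarrow> real) set"
  assumes C: "C \<noteq> {}" "\<And>a. a \<in> C \<Longrightarrow> sublinear_functional a \<and> a \<le> q"
    and chain: "\<And>a b. a \<in> C \<Longrightarrow> b \<in> C \<Longrightarrow> a \<le> b \<or> b \<le> a"
  obtains u where "sublinear_functional u" "\<And>a. a \<in> C \<Longrightarrow> u \<le> a"
proof -
  define u where "u x = (INF a\<in>C. a x)" for x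
  have bdd: "bdd_below ((\<lambda>a. a x) ` C)" for x
  proof (rule bdd_belowI2)
    fix a assume a: "a \<in> C"
    have "- q (- x) \<le> - a (- x)" using C(2)[OF a] by (simp add: le_fun_def)
    then show "- q (- x) \<le> a x" using sublinear_functional_lower[of a x] C(2)[OF a] by simp
  qed
  have lower: "u x \<le> a x" if "a \<in> C" for a x
    unfolding u_def using bdd that by (rule cINF_lower)
  have approx: "\<exists>a\<in>C. a x < u x + e" if "0 < e" for x e
  proof -
    have "\<exists>v\<in>(\<lambda>a. a x) ` C. v < u x + e"
      unfolding u_def by (rule cInf_lessD) (use that C(1) in auto)
    then show ?thesis by auto
  qed
  have "sublinear_functional u"
    unfolding sublinear_functional_def
  proof (intro conjI allI impI)
    fix x y
    show "u (x + y) \<le> u x + u y"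
    proof (rule field_le_epsilon)
      fix e :: real assume "0 < e"
      then obtain a b where ab: "a \<in> C" "a x < u x + e/2" "b \<in> C" "b y < u y + e/2"
        using approx[of "e/2" x] approx[of "e/2" y] by auto
      obtain c where c: "c \<in> C" "c x \<le> a x" "c y \<le> b y"
        using chain[OF ab(1,3)] ab by (auto simp: le_fun_def)
      have "u (x + y) \<le> c (x + y)" using lower c by blast
      also have "\<dots> \<le> c x + c y" using C(2)[OF c(1)] unfolding sublinear_functional_def by blast
      finally show "u (x + y) \<le> u x + u y + e" using c ab by simp
    qed
  next
    fix t :: real and x assume t: "0 < t"
    show "u (t *\<^sub>R x) \<le> t * u x"
    proof (rule field_le_epsilon)
      fix e :: real assume "0 < e"
      then obtain a where a: "a \<in> C" "a x < u x + e / t" using approx[of "e/t" x] t by auto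
      have "u (t *\<^sub>R x) \<le> a (t *\<^sub>R x)" using lower a by blast
      also have "\<dots> \<le> t * a x"
        using C(2)[OF a(1)] t unfolding sublinear_functional_def by blast
      also have "\<dots> \<le> t * (u x + e / t)" using a t by (intro mult_left_mono) auto
      also have "\<dots> = t * u x + e" using t by (simp add: field_simps)
      finally show "u (t *\<^sub>R x) \<le> t * u x + e" .
    qed
  qed
  then show thesis using lower by (intro that[of u]) (auto simp: le_fun_def)
qed

text \<open>The Hahn-Banach theorem by way of minimality: the Zorn lemma gives a minimal sublinear functional below \<open>q\<close>;
shrinking it does not change it, which says that it is superadditive, hence linear.\<close>

lemma sublinear_dominates_linear:
  fixes q :: "'x::real_vector \<Rightarrow> real"
  assumes q: "sublinear_functional q"
  obtains f where "linear f" "\<And>x. f x \<le> q x"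
proof -
  define A where "A = {a. sublinear_functional a \<and> a \<le> q}"
  define P :: "('x \<Rightarrow> real) \<Rightarrow> ('x \<Rightarrow> real) \<Rightarrow> bool" where "P a b \<longleftrightarrow> b \<le> a" for a b
  have "\<exists>m\<in>A. \<forall>a\<in>A. P m a \<longrightarrow> a = m"
  proof (rule predicate_Zorn)
    show "partial_order_on A (relation_of P A)"
      by (rule partial_order_on_relation_ofI) (auto simp: P_def)
  next
    fix C assume C: "C \<in> Chains (relation_of P A)"
    show "\<exists>u\<in>A. \<forall>a\<in>C. P a u"
    proof (cases "C = {}")
      case True
      then show ?thesis using q by (auto simp: A_def)
    next
      case False
      have rel: "a \<in> A \<and> b \<in> A \<and> (b \<le> a \<or> a \<le> b)" if "a \<in> C" "b \<in> C" for a b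
        using C that unfolding Chains_def relation_of_def P_def by auto
      obtain u where u: "sublinear_functional u" "\<And>a. a \<in> C \<Longrightarrow> u \<le> a"
        by (rule Inf_chain_sublinear_functional[of C q]) (use False rel in \<open>auto simp: A_def\<close>)
      obtain a where "a \<in> C" using False by blast
      then have "u \<le> q" using u(2)[of a] rel[of a a] by (auto simp: A_def)
      then show ?thesis using u by (auto simp: A_def P_def)
    qed
  qed
  then obtain m where m: "sublinear_functional m" "m \<le> q"
    and min: "\<And>a. sublinear_functional a \<Longrightarrow> a \<le> m \<Longrightarrow> a = m"
    unfolding A_def P_def by (auto intro: order_trans)
  have sub: "m (x + y) \<le> m x + m y" for x y
    using m(1) unfolding sublinear_functional_def by blast
  have super: "m x + m y \<le> m (x + y)" for x y
  proof -
    obtain a where a: "sublinear_functional a" "\<And>x. a x \<le> m x" "\<And>x. a x \<le> m (x + y) - m y"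
      using sublinear_functional_shrink[OF m(1)] by metis
    \<comment> \<open>Minimality; the third property of \<open>a\<close> then reads as superadditivity of \<open>m\<close>.\<close>
    have "a = m" using a by (intro min) (auto simp: le_fun_def)
    with a(3)[of x] show ?thesis by simp
  qed
  have add: "m (x + y) = m x + m y" for x y using sub super by (simp add: antisym)
  have neg: "m (- x) = - m x" for x
    using add[of x "- x"] sublinear_functional_scale[OF m(1), of 0 x] by simp
  have "m (t *\<^sub>R x) = t * m x" for t x
  proof (cases "0 \<le> t")
    case False
    then show ?thesis
      using sublinear_functional_scale[OF m(1), of "- t" x] neg[of "t *\<^sub>R x"] by simp
  qed (rule sublinear_functional_scale[OF m(1)])
  then have "linear m" using add by (intro linearI) auto
  then show thesis using m(2) by (intro that) (auto simp: le_fun_def)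
qed

lemma real_norming_functional:
  fixes x0 :: "'x::real_normed_vector"
  obtains f where "linear f" "\<And>x. \<bar>f x\<bar> \<le> norm x" "f x0 = norm x0"
proof -
  have "sublinear_functional (norm :: 'x \<Rightarrow> real)"
    unfolding sublinear_functional_def by (auto simp: norm_triangle_ineq)
  then obtain q where q: "sublinear_functional q" "\<And>x::'x. q x \<le> norm x"
    "\<And>x. q x \<le> norm (x + x0) - norm x0"
    using sublinear_functional_shrink by metis
  obtain f where f: "linear f" "\<And>x. f x \<le> q x" using sublinear_dominates_linear[OF q(1)] by metis
  have le: "f x \<le> norm x" for x using f(2)[of x] q(2)[of x] by simp
  have neg: "f (- x) = - f x" for x using f(1) by (rule linear_neg)
  have "\<bar>f x\<bar> \<le> norm x" for x using le[of x] le[of "- x"] neg[of x] by simp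
  \<comment> \<open>At \<open>- x0\<close> the functional \<open>q\<close> is at most \<open>- norm x0\<close>.\<close>
  moreover have "norm x0 \<le> f x0" using f(2)[of "- x0"] q(3)[of "- x0"] neg[of x0] by simp
  ultimately show thesis using that[OF f(1)] le[of x0] by (simp add: antisym)
qed

lemma inner_one_of_real: "inner 1 (of_real r :: 's::{real_normed_field, euclidean_space}) = r"
  by (simp add: of_real_def power2_norm_eq_inner[symmetric])

text \<open>Since \<open>inner 1\<close> is the real part, this allows norms of scalars, and thereby operator norms, to be
estimated through real parts.\<close>

lemma norm_attained_by_rotation:
  fixes c :: "'s::{real_normed_field, euclidean_space}"
  shows "\<exists>k. norm k = 1 \<and> norm c = inner 1 (k * c)"
proof (cases "c = 0")
  case True
  then show ?thesis by (intro exI[of _ 1]) simp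
next
  case False
  define k where "k = of_real (norm c) / c"
  have "norm k = 1" "k * c = of_real (norm c)" using False by (simp_all add: k_def norm_divide)
  then show ?thesis by (metis inner_one_of_real)
qed

lemma norm_le_real_part:
  fixes c :: "'s::{real_normed_field, euclidean_space}"
  assumes "\<And>k. norm k = 1 \<Longrightarrow> inner 1 (k * c) \<le> b"
  shows "norm c \<le> b"
  using norm_attained_by_rotation[of c] assms by auto

text \<open>The bilinear form \<open>inner 1 (a * g)\<close> is nondegenerate, as \<open>a = 1 / g\<close> shows, so in finite dimension it
represents every real linear functional.\<close>

lemma inner_one_represents:
  fixes \<phi> :: "'s::{real_normed_field, euclidean_space} \<Rightarrow> real"
  assumes "linear \<phi>"
  shows "\<exists>g. \<forall>a. inner 1 (a * g) = \<phi> a"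
proof -
  define \<Phi> :: "'s \<Rightarrow> 's" where "\<Phi> g = (\<Sum>b\<in>Basis. inner 1 (b * g) *\<^sub>R b)" for g
  have basis: "inner (\<Phi> g) b = inner 1 (b * g)" if "b \<in> Basis" for g b
    using that unfolding \<Phi>_def by (simp add: inner_sum_left_Basis)
  have lin: "linear (\<lambda>a. inner 1 (a * g))" for g :: 's
    by (intro linearI) (simp_all add: inner_add_right distrib_right)
  have "linear \<Phi>"
    unfolding \<Phi>_def
    by (intro linearI) (simp_all add: inner_add_right distrib_left scaleR_add_left sum.distrib
        scaleR_sum_right)
  moreover have "inj \<Phi>"
  proof (subst linear_injective_0[OF \<open>linear \<Phi>\<close>], intro allI impI)
    fix g assume "\<Phi> g = 0"
    then have "inner 1 (b * g) = 0" if "b \<in> Basis" for b using basis[OF that, of g] by simp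
    then have "(\<lambda>a. inner 1 (a * g)) = (\<lambda>a. 0)"
      by (intro linear_eq_stdbasis[OF lin]) (auto simp: module_hom_zero)
    then show "g = 0" using norm_attained_by_rotation[of g] by (metis norm_eq_zero)
  qed
  ultimately have "surj \<Phi>" by (rule linear_injective_imp_surjective) (rule refl)
  then obtain g where g: "\<Phi> g = (\<Sum>b\<in>Basis. \<phi> b *\<^sub>R b)" by (metis surjD)
  have "inner 1 (b * g) = \<phi> b" if "b \<in> Basis" for b
    using basis[OF that, of g] that unfolding g by (simp add: inner_sum_left_Basis)
  then have "(\<lambda>a. inner 1 (a * g)) = \<phi>" by (intro linear_eq_stdbasis[OF lin assms])
  then show ?thesis by (auto simp: fun_eq_iff)
qed

lemma banach_space_over_facts:
  assumes "banach_space_over sX"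
  shows "vector_space sX" "sX (of_real r) x = r *\<^sub>R x" "norm (sX c x) = norm c * norm x"
    "sX c (x + y) = sX c x + sX c y" "sX (c + d) x = sX c x + sX d x" "sX c (sX d x) = sX (c * d) x"
  using assms unfolding banach_space_over_def vector_space_def by auto

lemma bounded_ops_iff:
  fixes sX :: "'s::{real_normed_field, euclidean_space} \<Rightarrow> 'x::banach \<Rightarrow> 'x"
  assumes "banach_space_over sX" "banach_space_over sY"
  shows "f \<in> bounded_ops sX sY \<longleftrightarrow> bounded_linear f \<and> (\<forall>c x. f (sX c x) = sY c (f x))"
proof
  note X = banach_space_over_facts[OF assms(1)] and Y = banach_space_over_facts[OF assms(2)]
  assume f: "f \<in> bounded_ops sX sY"
  then interpret Vector_Spaces.linear sX sY f unfolding bounded_ops_def by simp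
  obtain C where C: "\<And>x. norm (f x) \<le> C * norm x" using f unfolding bounded_ops_def by blast
  have "bounded_linear f"
    by (rule bounded_linear_intro[of _ C])
      (use C scale[of "of_real _"] in \<open>auto simp: add X Y mult.commute\<close>)
  then show "bounded_linear f \<and> (\<forall>c x. f (sX c x) = sY c (f x))" using scale by simp
next
  note X = banach_space_over_facts[OF assms(1)] and Y = banach_space_over_facts[OF assms(2)]
  assume f: "bounded_linear f \<and> (\<forall>c x. f (sX c x) = sY c (f x))"
  have "Vector_Spaces.linear sX sY f"
    using f X(1) Y(1) by (simp add: Vector_Spaces.linear_iff linear_simps)
  moreover have "\<exists>C. \<forall>x. norm (f x) \<le> C * norm x" using f onorm[of f] by blast
  ultimately show "f \<in> bounded_ops sX sY" unfolding bounded_ops_def by simp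
qed

lemma banach_space_over_scalars:
  "banach_space_over ((*) :: 's::{real_normed_field, euclidean_space} \<Rightarrow> 's \<Rightarrow> 's)"
  unfolding banach_space_over_def
  by (auto simp: vector_space_def algebra_simps norm_mult scaleR_conv_of_real)

lemma dual_space_iff:
  assumes "banach_space_over sX"
  shows "f \<in> dual_space sX \<longleftrightarrow> bounded_linear f \<and> (\<forall>c x. f (sX c x) = c * f x)"
  unfolding dual_space_def by (rule bounded_ops_iff[OF assms banach_space_over_scalars])

text \<open>From a real functional \<open>f\<close> the functional over the scalar field is recovered as the \<open>g\<close> whose real part is \<open>f\<close>:
the scalar \<open>g x\<close> represents \<open>a \<mapsto> f (a x)\<close>. Uniqueness of the representing scalar makes \<open>g\<close> linear over the field.\<close>

lemma dual_space_separates: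
  fixes sX :: "'s::{real_normed_field, euclidean_space} \<Rightarrow> 'x::banach \<Rightarrow> 'x"
  assumes sX: "banach_space_over sX" and "x0 \<noteq> 0"
  obtains g where "g \<in> dual_space sX" "g x0 \<noteq> 0"
proof -
  note X = banach_space_over_facts[OF sX]
  obtain f :: "'x \<Rightarrow> real" where f: "linear f" "\<And>x. \<bar>f x\<bar> \<le> norm x" "f x0 = norm x0"
    using real_norming_functional by metis
  have "\<exists>z. \<forall>a. inner 1 (a * z) = f (sX a x)" for x
  proof (rule inner_one_represents, rule linearI)
    fix a b :: 's and r :: real
    show "f (sX (a + b) x) = f (sX a x) + f (sX b x)" using f(1) X(5) by (simp add: linear_add)
    have "sX (r *\<^sub>R a) x = r *\<^sub>R sX a x" using X(2)[of r "sX a x"] X(6)[of "of_real r" a x]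
      by (simp add: scaleR_conv_of_real)
    then show "f (sX (r *\<^sub>R a) x) = r *\<^sub>R f (sX a x)" using f(1) by (simp add: linear_cmul)
  qed
  then obtain g where g: "\<And>x a. inner 1 (a * g x) = f (sX a x)" by metis
  have uniq: "u = v" if "\<And>a. inner 1 (a * u) = inner 1 (a * v)" for u v :: 's
  proof -
    have "inner 1 (k * (u - v)) = 0" for k using that[of k] by (simp add: right_diff_distrib inner_diff_right)
    then show ?thesis using norm_attained_by_rotation[of "u - v"] by (metis norm_eq_zero right_minus_eq)
  qed
  have add: "g (x + y) = g x + g y" for x y
    by (rule uniq) (simp add: g X(4) linear_add[OF f(1)] distrib_left inner_add_right)
  have scale: "g (sX c x) = c * g x" for c x
    by (rule uniq) (simp add: g X(6) mult.assoc[symmetric])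
  have bound: "norm (g x) \<le> norm x" for x
  proof (rule norm_le_real_part)
    fix k :: 's assume "norm k = 1"
    then show "inner 1 (k * g x) \<le> norm x" using f(2)[of "sX k x"] by (simp add: g X(3))
  qed
  have "bounded_linear g"
    by (rule bounded_linear_intro[of _ 1])
      (use add bound scale[of "of_real _"] in \<open>auto simp: X(2) scaleR_conv_of_real\<close>)
  then have "g \<in> dual_space sX" using scale by (simp add: dual_space_iff[OF sX])
  moreover have "inner 1 (1 * g x0) = norm x0" unfolding g using X(2)[of 1 x0] f(3) by simp
  then have "g x0 \<noteq> 0" using assms(2) by auto
  ultimately show thesis by (rule that)
qed


section \<open>The Ekeland variational principle\<close>

text \<open>Consider the sets \<open>S x\<close> of points \<open>y\<close> with \<open>f y + \<epsilon> * dist x y \<le> f x\<close>. Moving within them to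
nearly minimal values of \<open>f\<close> produces nested closed sets with diameters tending to 0. Their common
point is \<open>x0\<close>.\<close>

lemma ekeland_variational_principle:
  fixes f :: "'x::complete_space \<Rightarrow> real"
  assumes bdd: "\<And>x. m \<le> f x"
    and lsc: "\<And>y e. 0 < e \<Longrightarrow> \<forall>\<^sub>F z in nhds y. f y - e < f z"
    and \<epsilon>: "0 < \<epsilon>"
  obtains x0 where "f x0 + \<epsilon> * dist a x0 \<le> f a" "\<And>x. f x0 - \<epsilon> * dist x0 x \<le> f x"
proof -
  define S where "S x = {y. f y + \<epsilon> * dist x y \<le> f x}" for x
  have refl: "x \<in> S x" for x by (simp add: S_def)
  have trans: "z \<in> S x" if "y \<in> S x" "z \<in> S y" for x y z
  proof -
    have "\<epsilon> * dist x z \<le> \<epsilon> * dist x y + \<epsilon> * dist y z"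
      using \<epsilon> dist_triangle[of x z y] by (simp add: distrib_left[symmetric])
    then show ?thesis using that by (simp add: S_def)
  qed
  have "\<exists>X. X 0 = a \<and> (\<forall>n. X (Suc n) \<in> S (X n) \<and> (\<forall>y\<in>S (X n). f (X (Suc n)) \<le> f y + (1/2) ^ n))"
  proof -
    have "\<exists>X. \<forall>n. (n = 0 \<longrightarrow> X n = a) \<and>
        (X (Suc n) \<in> S (X n) \<and> (\<forall>y\<in>S (X n). f (X (Suc n)) \<le> f y + (1/2) ^ n))"
    proof (rule dependent_nat_choice)
      fix x and n :: nat
      have bdd': "bdd_below (f ` S x)" by (rule bdd_belowI2[of _ m]) (rule bdd)
      have "\<exists>v\<in>f ` S x. v < Inf (f ` S x) + (1/2) ^ n"
        by (rule cInf_lessD) (use refl[of x] in auto)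
      then obtain y where y: "y \<in> S x" "f y < Inf (f ` S x) + (1/2) ^ n" by blast
      have "f y \<le> f z + (1/2) ^ n" if "z \<in> S x" for z
      proof -
        have "Inf (f ` S x) \<le> f z" using bdd' that by (rule cINF_lower)
        with y(2) show ?thesis by simp
      qed
      with y(1)
      show "\<exists>y. (Suc n = 0 \<longrightarrow> y = a) \<and> (y \<in> S x \<and> (\<forall>z\<in>S x. f y \<le> f z + (1/2) ^ n))"
        by auto
    qed auto
    then show ?thesis by blast
  qed
  then obtain X where X0: "X 0 = a" and step: "\<And>n. X (Suc n) \<in> S (X n)"
    and small: "\<And>n y. y \<in> S (X n) \<Longrightarrow> f (X (Suc n)) \<le> f y + (1/2) ^ n" by blast
  have mono: "X m \<in> S (X n)" if "n \<le> m" for m n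
    using that by (induction m rule: dec_induct) (auto intro: refl trans step)
  have near: "\<epsilon> * dist (X (Suc n)) y \<le> (1/2) ^ n" if "y \<in> S (X (Suc n))" for n y
    using small[OF trans[OF step that]] that by (simp add: S_def)
  have lim0: "(\<lambda>n. (1/2) ^ n / \<epsilon>) \<longlonglongrightarrow> 0"
    by (intro tendsto_divide_zero LIMSEQ_power_zero) simp
  have "Cauchy X"
  proof (rule metric_CauchyI)
    fix e :: real assume "0 < e"
    then have "\<forall>\<^sub>F n in sequentially. (1/2) ^ n / \<epsilon> < e / 2"
      by (intro order_tendstoD[OF lim0]) simp
    then obtain n where n: "(1/2) ^ n / \<epsilon> < e / 2" by (auto simp: eventually_sequentially)
    have d: "dist (X (Suc n)) (X k) < e / 2" if "Suc n \<le> k" for k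
    proof -
      have "dist (X (Suc n)) (X k) \<le> (1/2) ^ n / \<epsilon>"
        using near[OF mono[OF that]] \<epsilon> by (simp add: field_simps)
      with n show ?thesis by linarith
    qed
    show "\<exists>N. \<forall>i\<ge>N. \<forall>j\<ge>N. dist (X i) (X j) < e"
      using d dist_triangle_half_r by blast
  qed
  then obtain x0 where x0: "X \<longlonglongrightarrow> x0" by (auto simp: Cauchy_convergent_iff convergent_def)
  have in_S: "x0 \<in> S (X n)" for n
  proof (rule ccontr)
    assume "x0 \<notin> S (X n)"
    define g where "g = f x0 + \<epsilon> * dist (X n) x0 - f (X n)"
    have g: "0 < g" using \<open>x0 \<notin> S (X n)\<close> by (simp add: g_def S_def)
    have "\<forall>\<^sub>F k in sequentially. f x0 - g / 2 < f (X k)"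
      using x0 lsc[of "g/2" x0] g unfolding filterlim_iff by auto
    moreover have "(\<lambda>k. \<epsilon> * dist (X n) (X k)) \<longlonglongrightarrow> \<epsilon> * dist (X n) x0"
      by (intro tendsto_intros x0)
    then have "\<forall>\<^sub>F k in sequentially. \<epsilon> * dist (X n) x0 - g / 2 < \<epsilon> * dist (X n) (X k)"
      by (rule order_tendstoD) (use g in auto)
    ultimately have "\<forall>\<^sub>F k in sequentially. False"
      using eventually_ge_at_top[of n]
    proof eventually_elim
      case (elim k)
      have "f (X k) + \<epsilon> * dist (X n) (X k) \<le> f (X n)" using mono[OF elim(3)] by (simp add: S_def)
      with elim show ?case unfolding g_def by argo
    qed
    then show False by simp
  qed
  show thesis
  proof
    show "f x0 + \<epsilon> * dist a x0 \<le> f a" using in_S[of 0] by (simp add: S_def X0)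
    fix x
    show "f x0 - \<epsilon> * dist x0 x \<le> f x"
    proof (rule ccontr)
      assume neg: "\<not> f x0 - \<epsilon> * dist x0 x \<le> f x"
      then have "x \<in> S x0" by (simp add: S_def)
      then have "x \<in> S (X (Suc n))" for n by (rule trans[OF in_S])
      then have "dist (X (Suc n)) x \<le> (1/2) ^ n / \<epsilon>" for n
        using near[of x n] \<epsilon> by (simp add: field_simps)
      then have "(\<lambda>n. dist (X (Suc n)) x) \<longlonglongrightarrow> 0"
        by (intro Lim_null_comparison[OF always_eventually lim0]) simp
      then have "(\<lambda>n. X (Suc n)) \<longlonglongrightarrow> x" by (rule tendsto_dist_iff[THEN iffD2])
      then have "x = x0" using LIMSEQ_Suc[OF x0] LIMSEQ_unique by blast
      with neg show False by simp
    qed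
  qed
qed


section \<open>The Hilbert space and its dual\<close>

text \<open>The tangent of the convex function \<open>t \<mapsto> t powr p\<close> at \<open>a\<close> lies below its graph. In this form it is the
Young inequality for the product of \<open>b\<close> and \<open>a powr (p - 1)\<close>.\<close>

lemma powr_gradient_le:
  fixes a b p :: real
  assumes "1 < p" "0 \<le> a" "0 \<le> b"
  shows "a powr p + p * a powr (p - 1) * (b - a) \<le> b powr p"
proof -
  define q where "q = p / (p - 1)"
  have q: "1 < q" "1 / p + 1 / q = 1" "(p - 1) * q = p" "p / q = p - 1"
    using assms(1) by (simp_all add: q_def field_simps)
  have "b * a powr (p - 1) \<le> b powr p / p + (a powr (p - 1)) powr q / q"
    using assms q by (intro Youngs_inequality) auto
  also have "(a powr (p - 1)) powr q = a powr p" using q(3) by (simp add: powr_powr)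
  finally have "p * (b * a powr (p - 1)) \<le> p * (b powr p / p + a powr p / q)"
    using assms(1) by (intro mult_left_mono) auto
  also have "\<dots> = b powr p + (p / q) * a powr p" using assms(1) by (simp add: field_simps)
  also have "\<dots> = b powr p + (p - 1) * a powr p" by (simp only: q(4))
  finally have "p * (b * a powr (p - 1)) \<le> b powr p + (p - 1) * a powr p" .
  moreover have "a powr (p - 1) * a = a powr p"
  proof (cases "a = 0")
    case False
    then show ?thesis using assms powr_add[of a "p - 1" 1] by simp
  qed simp
  ultimately show ?thesis by (simp add: algebra_simps)
qed

text \<open>The isometry \<open>\<nu>\<close> is linear, while the Riesz map of the Hilbert space is conjugate linear, so \<open>\<nu>\<close> is in
general not given by the inner product. The two are connected by the map \<open>riesz\<close> below.\<close>

locale hilbert_pairing =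
  fixes sK :: "'s::{real_normed_field, euclidean_space} \<Rightarrow> 'k::banach \<Rightarrow> 'k"
    and ip :: "'k \<Rightarrow> 'k \<Rightarrow> 's" and \<nu> :: "'k \<Rightarrow> 'k \<Rightarrow> 's"
  assumes hilbert: "hilbert_space_over sK ip" and dual_iso: "isometric_dual_iso sK \<nu>"
begin

lemma banach_K: "banach_space_over sK"
  using hilbert unfolding hilbert_space_over_def by blast

lemma ip_add_left: "ip (u + w) v = ip u v + ip w v"
  and ip_scale_left: "ip (sK c u) v = c * ip u v"
  and ip_swap: "ip v u = of_real (2 * inner 1 (ip u v)) - ip u v"
  and ip_self: "ip u u = of_real ((norm u)\<^sup>2)"
proof -
  have "Vector_Spaces.linear sK (*) (\<lambda>u. ip u v)"
    using hilbert unfolding hilbert_space_over_def by blast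
  then show "ip (u + w) v = ip u v + ip w v" "ip (sK c u) v = c * ip u v"
    by (auto simp: Vector_Spaces.linear_iff)
  show "ip v u = of_real (2 * inner 1 (ip u v)) - ip u v" "ip u u = of_real ((norm u)\<^sup>2)"
    using hilbert unfolding hilbert_space_over_def scalar_cnj_def by blast+
qed

lemma ip_scaleR_left: "ip (r *\<^sub>R u) v = r *\<^sub>R ip u v"
  using ip_scale_left[of "of_real r" u v]
  by (simp add: banach_space_over_facts(2)[OF banach_K] scaleR_conv_of_real)

lemma ip_add_right: "ip v (u + w) = ip v u + ip v w"
  by (simp add: ip_swap[of v] ip_add_left inner_add_right distrib_left)

definition re_ip :: "'k \<Rightarrow> 'k \<Rightarrow> real" where
  "re_ip u v = inner 1 (ip u v)"

lemma re_ip_commute: "re_ip u v = re_ip v u"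
  unfolding re_ip_def ip_swap[of u v] inner_diff_right inner_one_of_real by simp

lemma re_ip_add_left: "re_ip (u + w) v = re_ip u v + re_ip w v"
  by (simp add: re_ip_def ip_add_left inner_add_right)

lemma re_ip_scaleR_left: "re_ip (r *\<^sub>R u) v = r * re_ip u v"
  by (simp add: re_ip_def ip_scaleR_left)

lemma re_ip_scaleR_right: "re_ip u (r *\<^sub>R v) = r * re_ip u v"
  by (simp add: re_ip_commute[of u] re_ip_scaleR_left)

lemma re_ip_add_right: "re_ip v (u + w) = re_ip v u + re_ip v w"
  by (simp add: re_ip_commute[of v] re_ip_add_left)

lemma re_ip_diff_left: "re_ip (u - w) v = re_ip u v - re_ip w v"
  using re_ip_add_left[of "u - w" w v] by simp

lemma re_ip_diff_right: "re_ip v (u - w) = re_ip v u - re_ip v w"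
  by (simp add: re_ip_commute[of v] re_ip_diff_left)

lemma re_ip_self: "re_ip u u = (norm u)\<^sup>2"
  by (simp only: re_ip_def ip_self inner_one_of_real)

text \<open>The Cauchy-Schwarz inequality for the real part; rotating the first argument by a scalar of norm 1
extends it to the inner product in \<open>norm_ip_le\<close>.\<close>

lemma re_ip_le: "re_ip u v \<le> norm u * norm v"
proof (cases "u = 0 \<or> v = 0")
  case True
  then show ?thesis
    using re_ip_scaleR_left[of 0 u v] re_ip_scaleR_right[of u 0 v] by auto
next
  case False
  let ?a = "norm v" and ?b = "norm u"
  have "0 \<le> re_ip (?a *\<^sub>R u - ?b *\<^sub>R v) (?a *\<^sub>R u - ?b *\<^sub>R v)" by (simp add: re_ip_self)
  also have "\<dots> = ?a * ?a * re_ip u u - 2 * ?a * ?b * re_ip u v + ?b * ?b * re_ip v v"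
    unfolding re_ip_diff_left re_ip_diff_right re_ip_scaleR_left re_ip_scaleR_right re_ip_commute[of v u]
    by (simp add: algebra_simps)
  also have "\<dots> = ?a * ?a * (?b * ?b) - 2 * ?a * ?b * re_ip u v + ?b * ?b * (?a * ?a)"
    by (simp add: re_ip_self power2_eq_square)
  finally have "(2 * ?a * ?b) * re_ip u v \<le> (2 * ?a * ?b) * (norm u * norm v)"
    by (simp add: algebra_simps)
  then show ?thesis using False by (subst (asm) mult_le_cancel_left_pos) auto
qed

lemma norm_ip_le: "norm (ip u v) \<le> norm u * norm v"
proof (rule norm_le_real_part)
  fix k :: 's assume "norm k = 1"
  then show "inner 1 (k * ip u v) \<le> norm u * norm v"
    using re_ip_le[of "sK k u" v]
    by (simp add: re_ip_def ip_scale_left banach_space_over_facts(3)[OF banach_K])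
qed

lemma abs_re_ip_le: "\<bar>re_ip u v\<bar> \<le> norm u * norm v"
  using re_ip_le[of u v] re_ip_le[of "(-1) *\<^sub>R u" v] by (simp only: re_ip_scaleR_left) simp

lemma bounded_bilinear_re_ip: "bounded_bilinear re_ip"
  by (rule bounded_bilinear.intro)
    (auto simp: re_ip_add_left re_ip_add_right re_ip_scaleR_left re_ip_scaleR_right
      intro!: exI[of _ 1] abs_re_ip_le)

lemma ip_in_dual: "(\<lambda>u. ip u v) \<in> dual_space sK"
proof -
  have "bounded_linear (\<lambda>u. ip u v)"
    by (rule bounded_linear_intro[of _ "norm v"]) (auto simp: ip_add_left ip_scaleR_left norm_ip_le)
  then show ?thesis by (simp add: dual_space_iff[OF banach_K] ip_scale_left)
qed

lemma \<nu>_in_dual: "\<nu> v \<in> dual_space sK"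
  using dual_iso by (auto simp: isometric_dual_iso_def bij_betw_def)

lemma \<nu>_add_left: "\<nu> (v + w) u = \<nu> v u + \<nu> w u"
  and \<nu>_scale_left: "\<nu> (sK c v) u = c * \<nu> v u"
  and onorm_\<nu>: "onorm (\<nu> v) = norm v"
  using dual_iso by (auto simp: isometric_dual_iso_def)

lemma \<nu>_inj: "\<nu> v = \<nu> w \<longleftrightarrow> v = w"
  using dual_iso by (auto simp: isometric_dual_iso_def bij_betw_def inj_eq)

lemma \<nu>_le: "norm (\<nu> v u) \<le> norm v * norm u"
  using onorm[of "\<nu> v" u] \<nu>_in_dual[of v] by (simp add: dual_space_iff[OF banach_K] onorm_\<nu>)

lemma bounded_bilinear_\<nu>: "bounded_bilinear \<nu>"
proof
  fix r :: real and v w u :: 'k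
  interpret bounded_linear "\<nu> v" using \<nu>_in_dual by (simp add: dual_space_iff[OF banach_K])
  show "\<nu> v (w + u) = \<nu> v w + \<nu> v u" by (rule add)
  show "\<nu> v (r *\<^sub>R u) = r *\<^sub>R \<nu> v u" by (rule scaleR)
  show "\<nu> (v + w) u = \<nu> v u + \<nu> w u" by (rule \<nu>_add_left)
  show "\<nu> (r *\<^sub>R v) u = r *\<^sub>R \<nu> v u"
    using \<nu>_scale_left[of "of_real r" v u]
    by (simp add: banach_space_over_facts(2)[OF banach_K] scaleR_conv_of_real)
  show "\<exists>K. \<forall>a b. norm (\<nu> a b) \<le> norm a * norm b * K" using \<nu>_le by (intro exI[of _ 1]) simp
qed

text \<open>The conjugate linear isometry of \<open>K\<close> through which the pairing becomes the inner product; it transfers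
gradients, which are formed with the inner product, to elements paired by \<open>\<nu>\<close>.\<close>

definition riesz :: "'k \<Rightarrow> 'k" where
  "riesz v = inv \<nu> (\<lambda>u. ip u v)"

lemma \<nu>_riesz: "\<nu> (riesz v) u = ip u v"
proof -
  have "(\<lambda>u. ip u v) \<in> range \<nu>"
    using ip_in_dual[of v] dual_iso by (simp add: isometric_dual_iso_def bij_betw_def)
  then have "\<nu> (riesz v) = (\<lambda>u. ip u v)" unfolding riesz_def by (rule f_inv_into_f)
  then show ?thesis by simp
qed

lemma riesz_add: "riesz (v + w) = riesz v + riesz w"
  by (simp add: \<nu>_inj[symmetric] fun_eq_iff \<nu>_add_left \<nu>_riesz ip_add_right)

lemma norm_riesz: "norm (riesz v) = norm v"
proof (rule antisym)
  show "norm (riesz v) \<le> norm v"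
    unfolding onorm_\<nu>[symmetric, of "riesz v"]
    by (rule onorm_bound) (use norm_ip_le in \<open>simp_all add: \<nu>_riesz mult.commute\<close>)
  have "norm (ip v v) \<le> norm (riesz v) * norm v" using \<nu>_le[of "riesz v" v] by (simp add: \<nu>_riesz)
  then have "norm v * norm v \<le> norm (riesz v) * norm v" by (simp add: ip_self power2_eq_square norm_mult)
  then show "norm v \<le> norm (riesz v)" by (cases "v = 0") (auto simp: mult_le_cancel_right)
qed

lemma continuous_riesz: "continuous_on UNIV riesz"
proof -
  have "riesz (v - w) = riesz v - riesz w" for v w using riesz_add[of "v - w" w] by simp
  then have "dist (riesz v) (riesz w) = dist v w" for v w
    by (simp add: dist_norm norm_riesz flip: \<open>\<And>v w. riesz (v - w) = riesz v - riesz w\<close>)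
  then show ?thesis by (auto simp: continuous_on_iff)
qed

text \<open>Up to the factor \<open>p\<close>, the gradient of \<open>w \<mapsto> norm w powr p\<close>; at 0 it vanishes for every \<open>p\<close>, by the factor \<open>w\<close>.\<close>

definition duality_map :: "real \<Rightarrow> 'k \<Rightarrow> 'k" where
  "duality_map p w = norm w powr (p - 2) *\<^sub>R w"

lemma norm_duality_map: "norm (duality_map p w) = norm w powr (p - 1)"
proof (cases "w = 0")
  case False
  have "norm (duality_map p w) = norm w powr (p - 2) * norm w" by (simp add: duality_map_def)
  also have "\<dots> = norm w powr (p - 2) * norm w powr 1" using False by simp
  also have "\<dots> = norm w powr (p - 1)" by (simp only: powr_add[symmetric]) (simp add: algebra_simps)
  finally show ?thesis .
qed (simp add: duality_map_def)

lemma re_ip_duality_map: "re_ip w (duality_map p w) = norm w powr p"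
proof (cases "w = 0")
  case False
  have "re_ip w (duality_map p w) = norm w powr (p - 2) * (norm w)\<^sup>2"
    by (simp add: duality_map_def re_ip_scaleR_right re_ip_self)
  also have "\<dots> = norm w powr (p - 2) * norm w powr 2" using False by simp
  also have "\<dots> = norm w powr p" by (simp only: powr_add[symmetric]) (simp add: algebra_simps)
  finally show ?thesis .
qed (simp add: duality_map_def re_ip_scaleR_right[of _ 0, simplified])

lemma continuous_duality_map:
  assumes "1 < p"
  shows "continuous_on UNIV (duality_map p)"
proof -
  have "isCont (duality_map p) w" for w
  proof (cases "w = 0")
    case False
    then show ?thesis unfolding duality_map_def[abs_def] by (intro continuous_intros) auto
  next
    case True
    have "((\<lambda>v::'k. norm v powr (p - 1)) \<longlongrightarrow> norm (0::'k) powr (p - 1)) (at 0)"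
      using assms by (intro tendsto_powr2 tendsto_intros) auto
    then have "((\<lambda>v. norm (duality_map p v)) \<longlongrightarrow> 0) (at 0)" by (simp add: norm_duality_map)
    then have "(duality_map p \<longlongrightarrow> 0) (at 0)" by (rule tendsto_norm_zero_cancel)
    moreover have "duality_map p 0 = 0" by (simp add: duality_map_def)
    ultimately show ?thesis using True by (simp add: isCont_def)
  qed
  then show ?thesis by (simp add: continuous_on_eq_continuous_at)
qed

text \<open>Convexity of \<open>norm w powr p\<close>, reduced by the Cauchy-Schwarz inequality to the scalar case for the norms of \<open>u\<close> and
\<open>w\<close>.\<close>

lemma norm_powr_gradient:
  assumes "1 < p"
  shows "norm w powr p + p * re_ip (u - w) (duality_map p w) \<le> norm u powr p"
proof -
  have "re_ip (u - w) (duality_map p w) = re_ip u (duality_map p w) - norm w powr p"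
    by (simp add: re_ip_diff_left re_ip_duality_map)
  also have "\<dots> \<le> norm u * norm w powr (p - 1) - norm w powr p"
    using re_ip_le[of u "duality_map p w"] by (simp add: norm_duality_map)
  also have "norm w powr p = norm w * norm w powr (p - 1)"
    using re_ip_duality_map[of w p] re_ip_le[of w "duality_map p w"]
    by (cases "w = 0") (simp_all add: powr_mult_base)
  finally have "re_ip (u - w) (duality_map p w) \<le> norm w powr (p - 1) * (norm u - norm w)"
    by (simp add: algebra_simps)
  then have "p * re_ip (u - w) (duality_map p w) \<le> p * (norm w powr (p - 1) * (norm u - norm w))"
    using assms by (intro mult_left_mono) auto
  then show ?thesis using powr_gradient_le[OF assms, of "norm w" "norm u"] by (simp add: mult.assoc)
qed

end


section \<open>Bochner spaces of conjugate exponents\<close>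

locale Lp_duality = hilbert_pairing sK ip \<nu>
  for sK :: "'s::{real_normed_field, euclidean_space} \<Rightarrow> 'k::banach \<Rightarrow> 'k" and ip and \<nu> +
  fixes M :: "'w measure" and p q :: real
  assumes q: "1 < q" and conj: "1 / p + 1 / q = 1"
begin

abbreviation C where "C \<equiv> completion M"

lemma p: "1 < p"
proof -
  have "0 < 1 / q" "1 / q < 1" using q by simp_all
  then have inv: "0 < 1 / p" "1 / p < 1" using conj by linarith+
  then have "0 < p" by simp
  with inv(2) show ?thesis by simp
qed

lemma exponents: "(p - 1) * q = p" "p / q = p - 1" "0 < p" "0 < q"
  using p q conj by (auto simp: field_simps)

text \<open>The element of \<open>L\<^sup>q\<close> that norms \<open>R\<close> in \<open>L\<^sup>p\<close>. It replaces the abstract identification of the dual of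
\<open>L\<^sup>p\<close>.\<close>

definition dual_element :: "('w \<Rightarrow> 'k) \<Rightarrow> 'w \<Rightarrow> 'k" where
  "dual_element R \<omega> = riesz (duality_map p (R \<omega>))"

lemma norm_dual_element: "norm (dual_element R \<omega>) powr q = norm (R \<omega>) powr p"
  by (simp add: dual_element_def norm_riesz norm_duality_map powr_powr exponents)

lemma dual_element_Lp:
  assumes "R \<in> Lp_space M p"
  shows "dual_element R \<in> Lp_space M q"
proof -
  have "continuous_on UNIV (\<lambda>v. riesz (duality_map p v))"
    by (rule continuous_on_compose2[OF continuous_riesz continuous_duality_map[OF p]]) auto
  then have "bochner_measurable M (\<lambda>\<omega>. riesz (duality_map p (R \<omega>)))"
    using assms by (intro bochner_measurable_continuous[where f=R and h="\<lambda>v. riesz (duality_map p v)"])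
      (simp_all add: Lp_space_iff)
  then show ?thesis
    using assms by (simp add: dual_element_def[symmetric] Lp_space_iff norm_dual_element)
qed

lemma dual_element_norm:
  assumes "R \<in> Lp_space M p"
  shows "Lp_norm M q (dual_element R) = Lp_norm M p R powr (p - 1)"
proof -
  have "Lp_norm M q (dual_element R) = power_integral M p R powr (1 / q)"
    unfolding Lp_norm_eq[OF dual_element_Lp[OF assms]] by (simp add: power_integral_def norm_dual_element)
  also have "\<dots> = (Lp_norm M p R powr p) powr (1 / q)"
    by (simp only: Lp_norm_powr[OF assms exponents(3)])
  also have "\<dots> = Lp_norm M p R powr (p / q)" by (simp add: powr_powr)
  finally show ?thesis by (simp only: exponents(2))
qed

lemma duality_integrable:
  assumes "V \<in> Lp_space M p" "R \<in> Lp_space M p"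
  shows "integrable C (\<lambda>\<omega>. re_ip (V \<omega>) (duality_map p (R \<omega>)))"
proof (rule Bochner_Integration.integrable_bound[OF holder_Lp(1)[OF p q conj assms(1) dual_element_Lp[OF assms(2)]]])
  have "continuous_on UNIV (\<lambda>z::'k \<times> 'k. re_ip (fst z) (duality_map p (snd z)))"
    by (intro bounded_bilinear.continuous_on[OF bounded_bilinear_re_ip] continuous_on_fst
        continuous_on_id continuous_on_compose2[OF continuous_duality_map[OF p] continuous_on_snd]) simp
  then have "bochner_measurable M (\<lambda>\<omega>. re_ip (V \<omega>) (duality_map p (R \<omega>)))"
    using assms by (intro bochner_measurable_continuous2[where f=V and g=R and h="\<lambda>v w. re_ip v (duality_map p w)"])
      (simp_all add: Lp_space_iff)
  then show "(\<lambda>\<omega>. re_ip (V \<omega>) (duality_map p (R \<omega>))) \<in> borel_measurable C"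
    by (rule bochner_measurable_imp_borel)
  show "AE \<omega> in C. norm (re_ip (V \<omega>) (duality_map p (R \<omega>))) \<le> norm (norm (V \<omega>) * norm (dual_element R \<omega>))"
    using abs_re_ip_le by (intro AE_I2) (simp add: dual_element_def norm_riesz)
qed

text \<open>Up to the factor \<open>p\<close>, the derivative of \<open>power_integral M p\<close> at \<open>R\<close> in direction \<open>V\<close>.\<close>

definition gradient :: "('w \<Rightarrow> 'k) \<Rightarrow> ('w \<Rightarrow> 'k) \<Rightarrow> real" where
  "gradient R V = (\<integral>\<omega>. re_ip (V \<omega>) (duality_map p (R \<omega>)) \<partial>C)"

lemma power_integral_gradient:
  assumes "R \<in> Lp_space M p" "R' \<in> Lp_space M p"
  shows "power_integral M p R + p * gradient R (\<lambda>\<omega>. R' \<omega> - R \<omega>) \<le> power_integral M p R'"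
proof -
  have V: "(\<lambda>\<omega>. R' \<omega> - R \<omega>) \<in> Lp_space M p" using assms p by (intro Lp_space_diff) auto
  note int = duality_integrable[OF V assms(1)]
  have "power_integral M p R + p * gradient R (\<lambda>\<omega>. R' \<omega> - R \<omega>) =
      (\<integral>\<omega>. norm (R \<omega>) powr p + p * re_ip (R' \<omega> - R \<omega>) (duality_map p (R \<omega>)) \<partial>C)"
    unfolding power_integral_def gradient_def
    using assms(1) int by (subst Bochner_Integration.integral_add) (auto simp: Lp_space_iff)
  also have "\<dots> \<le> power_integral M p R'"
    unfolding power_integral_def
    using assms int norm_powr_gradient[OF p] by (intro integral_mono) (auto simp: Lp_space_iff)
  finally show ?thesis .
qed

text \<open>By convexity, the gradient at \<open>R + t V\<close> in direction \<open>V\<close> dominates the difference quotient between \<open>R\<close>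
and \<open>R + t V\<close>, and as \<open>t\<close> tends to 0 it converges to the gradient at \<open>R\<close> by dominated convergence. So a
lower bound along the ray, which Ekeland's principle supplies, bounds the gradient.\<close>

lemma directional_derivative_lower_bound:
  assumes R: "R \<in> Lp_space M p" and V: "V \<in> Lp_space M p" and "0 < \<delta>"
    and low: "\<And>t. 0 < t \<Longrightarrow> t < \<delta> \<Longrightarrow>
      power_integral M p R - t * c \<le> power_integral M p (\<lambda>\<omega>. R \<omega> + t *\<^sub>R V \<omega>)"
  shows "- c \<le> p * gradient R V"
proof -
  have L: "(\<lambda>\<omega>. R \<omega> + t *\<^sub>R V \<omega>) \<in> Lp_space M p" for t
    using R V p by (intro Lp_space_add Lp_space_scaleR) auto
  have ge_t: "- c \<le> p * gradient (\<lambda>\<omega>. R \<omega> + t *\<^sub>R V \<omega>) V" if t: "0 < t" "t < \<delta>" for t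
  proof -
    have "gradient (\<lambda>\<omega>. R \<omega> + t *\<^sub>R V \<omega>) (\<lambda>\<omega>. R \<omega> - (R \<omega> + t *\<^sub>R V \<omega>)) =
        gradient (\<lambda>\<omega>. R \<omega> + t *\<^sub>R V \<omega>) (\<lambda>\<omega>. (- t) *\<^sub>R V \<omega>)"
      by simp
    also have "\<dots> = - t * gradient (\<lambda>\<omega>. R \<omega> + t *\<^sub>R V \<omega>) V"
      unfolding gradient_def re_ip_scaleR_left by simp
    finally have "t * (- c) \<le> t * (p * gradient (\<lambda>\<omega>. R \<omega> + t *\<^sub>R V \<omega>) V)"
      using power_integral_gradient[OF L[of t] R] low[OF t] by (simp add: algebra_simps)
    then show ?thesis using t by (subst (asm) mult_le_cancel_left_pos) auto
  qed
  define t where "t n = \<delta> / (real n + 2)" for n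
  have t: "0 < t n" "t n < \<delta>" for n
    using \<open>0 < \<delta>\<close> by (auto simp: t_def field_simps add_pos_nonneg)
  have ge: "- c \<le> p * gradient (\<lambda>\<omega>. R \<omega> + t n *\<^sub>R V \<omega>) V" for n by (rule ge_t[OF t])
  have t_le: "\<bar>t n\<bar> \<le> \<delta>" for n using t[of n] by simp
  have t0: "t \<longlonglongrightarrow> 0"
    unfolding t_def using LIMSEQ_ignore_initial_segment[OF lim_const_over_n[of \<delta>], of 2] by (simp add: add.commute)
  \<comment> \<open>A majorant of \<open>R + t V\<close> for all \<open>t\<close> up to \<open>\<delta>\<close>; its power \<open>p - 1\<close> lies in \<open>L\<^sup>q\<close>, so its product with \<open>V\<close> is integrable.\<close>
  define W where "W \<omega> = norm (R \<omega>) + \<delta> * norm (V \<omega>)" for \<omega>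
  have W: "W \<in> Lp_space M p"
  proof (rule Lp_spaceI_bound[OF _ R V, where c="1 + \<delta>"])
    have "continuous_on UNIV (\<lambda>z::'k \<times> 'k. norm (fst z) + \<delta> * norm (snd z))"
      by (intro continuous_intros)
    then show "bochner_measurable M W"
      using R V unfolding W_def[abs_def] by (intro bochner_measurable_continuous2[where f=R and g=V and h="\<lambda>v w. norm v + \<delta> * norm w"])
        (simp_all add: Lp_space_iff)
    show "AE \<omega> in M. norm (W \<omega>) \<le> (1 + \<delta>) * (norm (R \<omega>) + norm (V \<omega>))"
      using \<open>0 < \<delta>\<close> by (intro AE_I2) (simp add: W_def algebra_simps)
  qed (use \<open>0 < \<delta>\<close> p in auto)
  have Wq: "(\<lambda>\<omega>. W \<omega> powr (p - 1)) \<in> Lp_space M q"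
  proof -
    have "continuous_on UNIV (\<lambda>x::real. \<bar>x\<bar> powr (p - 1))"
      using p by (intro continuous_on_powr' continuous_intros) auto
    then have "bochner_measurable M (\<lambda>\<omega>. \<bar>W \<omega>\<bar> powr (p - 1))"
      using W by (intro bochner_measurable_continuous[where f=W and h="\<lambda>x. \<bar>x\<bar> powr (p - 1)"]) (simp_all add: Lp_space_iff)
    moreover have "\<bar>W \<omega>\<bar> = W \<omega>" for \<omega> using \<open>0 < \<delta>\<close> by (simp add: W_def)
    ultimately show ?thesis using W by (simp add: Lp_space_iff powr_powr exponents)
  qed
  have "(\<lambda>n. gradient (\<lambda>\<omega>. R \<omega> + t n *\<^sub>R V \<omega>) V) \<longlonglongrightarrow> gradient R V"
    unfolding gradient_def
  proof (rule integral_dominated_convergence[where w="\<lambda>\<omega>. norm (V \<omega>) * norm (W \<omega> powr (p - 1))"])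
    show "(\<lambda>\<omega>. re_ip (V \<omega>) (duality_map p (R \<omega>))) \<in> borel_measurable C"
      using duality_integrable[OF V R] by auto
    show "(\<lambda>\<omega>. re_ip (V \<omega>) (duality_map p (R \<omega> + t n *\<^sub>R V \<omega>))) \<in> borel_measurable C" for n
      using duality_integrable[OF V L] by auto
    show "integrable C (\<lambda>\<omega>. norm (V \<omega>) * norm (W \<omega> powr (p - 1)))"
      by (rule holder_Lp(1)[OF p q conj V Wq])
    show "AE \<omega> in C. (\<lambda>n. re_ip (V \<omega>) (duality_map p (R \<omega> + t n *\<^sub>R V \<omega>))) \<longlonglongrightarrow>
        re_ip (V \<omega>) (duality_map p (R \<omega>))"
    proof (rule AE_I2)
      fix \<omega>
      have "(\<lambda>n. R \<omega> + t n *\<^sub>R V \<omega>) \<longlonglongrightarrow> R \<omega> + 0 *\<^sub>R V \<omega>" by (intro tendsto_intros t0)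
      then have "(\<lambda>n. duality_map p (R \<omega> + t n *\<^sub>R V \<omega>)) \<longlonglongrightarrow> duality_map p (R \<omega> + 0 *\<^sub>R V \<omega>)"
        by (rule isCont_tendsto_compose[rotated])
          (use continuous_duality_map[OF p] in \<open>simp add: continuous_on_eq_continuous_at\<close>)
      then show "(\<lambda>n. re_ip (V \<omega>) (duality_map p (R \<omega> + t n *\<^sub>R V \<omega>))) \<longlonglongrightarrow> re_ip (V \<omega>) (duality_map p (R \<omega>))"
        by (intro bounded_bilinear.tendsto[OF bounded_bilinear_re_ip tendsto_const]) simp
    qed
    show "AE \<omega> in C. norm (re_ip (V \<omega>) (duality_map p (R \<omega> + t n *\<^sub>R V \<omega>)))
        \<le> norm (V \<omega>) * norm (W \<omega> powr (p - 1))" for n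
    proof (rule AE_I2)
      fix \<omega>
      have "norm (R \<omega> + t n *\<^sub>R V \<omega>) \<le> W \<omega>"
        unfolding W_def using norm_triangle_ineq[of "R \<omega>" "t n *\<^sub>R V \<omega>"] t_le[of n]
        by (smt (verit) mult_right_mono norm_ge_zero norm_scaleR)
      then have "norm (duality_map p (R \<omega> + t n *\<^sub>R V \<omega>)) \<le> W \<omega> powr (p - 1)"
        unfolding norm_duality_map using p by (intro powr_mono2) auto
      then have "norm (V \<omega>) * norm (duality_map p (R \<omega> + t n *\<^sub>R V \<omega>)) \<le> norm (V \<omega>) * W \<omega> powr (p - 1)"
        by (intro mult_left_mono) auto
      then show "norm (re_ip (V \<omega>) (duality_map p (R \<omega> + t n *\<^sub>R V \<omega>))) \<le> norm (V \<omega>) * norm (W \<omega> powr (p - 1))"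
        using abs_re_ip_le[of "V \<omega>" "duality_map p (R \<omega> + t n *\<^sub>R V \<omega>)"] by simp
    qed
  qed
  then have "(\<lambda>n. p * gradient (\<lambda>\<omega>. R \<omega> + t n *\<^sub>R V \<omega>) V) \<longlonglongrightarrow> p * gradient R V"
    by (intro tendsto_intros)
  then show ?thesis by (rule LIMSEQ_le_const) (use ge in blast)
qed

end


section \<open>Upper bounds for analysis and synthesis\<close>

locale synthesis_setting = Lp_duality sK ip \<nu> M p q
  for sK :: "'s::{real_normed_field, euclidean_space} \<Rightarrow> 'k::banach \<Rightarrow> 'k" and ip and \<nu>
    and M :: "'w measure" and p q :: real +
  fixes sX :: "'s \<Rightarrow> 'x::banach \<Rightarrow> 'x" and \<Lambda> :: "'w \<Rightarrow> 'x \<Rightarrow> 'k"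
  assumes sX: "banach_space_over sX"
    and bounded: "\<And>\<omega>. \<omega> \<in> space M \<Longrightarrow> \<Lambda> \<omega> \<in> bounded_ops sX sK"
    and bm: "\<And>x. bochner_measurable M (\<lambda>\<omega>. \<Lambda> \<omega> x)"
    and wd: "synthesis_well_defined sX M \<nu> q \<Lambda>"
    and sf: "sigma_finite_measure M"
begin

abbreviation T where "T \<equiv> synthesis M \<nu> \<Lambda>"

lemma analysis_linear:
  assumes "\<omega> \<in> space M"
  shows "\<Lambda> \<omega> (x + y) = \<Lambda> \<omega> x + \<Lambda> \<omega> y" "\<Lambda> \<omega> (x - y) = \<Lambda> \<omega> x - \<Lambda> \<omega> y"
    "\<Lambda> \<omega> (r *\<^sub>R x) = r *\<^sub>R \<Lambda> \<omega> x" "\<Lambda> \<omega> 0 = 0"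
proof -
  have "bounded_linear (\<Lambda> \<omega>)" using bounded[OF assms] by (simp add: bounded_ops_iff[OF sX banach_K])
  then interpret bounded_linear "\<Lambda> \<omega>" .
  show "\<Lambda> \<omega> (x + y) = \<Lambda> \<omega> x + \<Lambda> \<omega> y" "\<Lambda> \<omega> (x - y) = \<Lambda> \<omega> x - \<Lambda> \<omega> y"
    "\<Lambda> \<omega> (r *\<^sub>R x) = r *\<^sub>R \<Lambda> \<omega> x" "\<Lambda> \<omega> 0 = 0"
    by (rule add diff scaleR zero)+
qed

lemma synthesis_integrable: "G \<in> Lp_space M q \<Longrightarrow> integrable C (\<lambda>\<omega>. \<nu> (G \<omega>) (\<Lambda> \<omega> x))"
  and synthesis_in_dual: "G \<in> Lp_space M q \<Longrightarrow> T G \<in> dual_space sX"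
  using wd by (auto simp: synthesis_well_defined_def)

lemma synthesis_bounded_linear: "G \<in> Lp_space M q \<Longrightarrow> bounded_linear (T G)"
  and synthesis_homogeneous: "G \<in> Lp_space M q \<Longrightarrow> T G (sX c x) = c * T G x"
  using synthesis_in_dual by (auto simp: dual_space_iff[OF sX])

lemma synthesis_add:
  assumes "F \<in> Lp_space M q" "G \<in> Lp_space M q"
  shows "T (\<lambda>\<omega>. F \<omega> + G \<omega>) = (\<lambda>x. T F x + T G x)"
  by (rule ext) (simp add: synthesis_def bounded_bilinear.add_left[OF bounded_bilinear_\<nu>]
      synthesis_integrable assms)

lemma synthesis_diff:
  assumes "F \<in> Lp_space M q" "G \<in> Lp_space M q"
  shows "T (\<lambda>\<omega>. F \<omega> - G \<omega>) = (\<lambda>x. T F x - T G x)"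
  by (rule ext) (simp add: synthesis_def bounded_bilinear.diff_left[OF bounded_bilinear_\<nu>]
      synthesis_integrable assms)

lemma synthesis_scale: "T (\<lambda>\<omega>. sK c (G \<omega>)) = (\<lambda>x. c * T G x)"
  by (rule ext) (simp add: synthesis_def \<nu>_scale_left)

lemma synthesis_cong_AE:
  assumes "F \<in> Lp_space M q" "G \<in> Lp_space M q" "AE \<omega> in M. F \<omega> = G \<omega>"
  shows "T F = T G"
proof
  fix x
  show "T F x = T G x"
    unfolding synthesis_def
    using synthesis_integrable[OF assms(1)] synthesis_integrable[OF assms(2)] AE_completion[OF assms(3)]
    by (intro integral_cong_AE) (auto elim: eventually_mono)
qed

lemma synthesis_zero_AE:
  assumes "G \<in> Lp_space M q" "AE \<omega> in M. \<Lambda> \<omega> x = 0"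
  shows "T G x = 0"
proof -
  have "T G x = (\<integral>\<omega>. 0 \<partial>C)"
    unfolding synthesis_def
    using synthesis_integrable[OF assms(1)] AE_completion[OF assms(2)]
    by (intro integral_cong_AE)
      (auto elim: eventually_mono simp: bounded_bilinear.zero_right[OF bounded_bilinear_\<nu>])
  then show ?thesis by simp
qed

text \<open>This identity connects the variational side with the operator \<open>T\<close>: derivatives along the range of \<open>U\<close> are real
parts of values of \<open>T\<close>.\<close>

lemma re_synthesis_dual_element:
  assumes "R \<in> Lp_space M p"
  shows "inner 1 (T (dual_element R) x) = gradient R (\<lambda>\<omega>. \<Lambda> \<omega> x)"
proof -
  have "inner 1 (T (dual_element R) x) = (\<integral>\<omega>. inner 1 (\<nu> (dual_element R \<omega>) (\<Lambda> \<omega> x)) \<partial>C)"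
    unfolding synthesis_def
    by (rule integral_inner_right[symmetric]) (rule synthesis_integrable[OF dual_element_Lp[OF assms]])
  then show ?thesis
    by (simp add: gradient_def dual_element_def \<nu>_riesz re_ip_def)
qed

lemma onorm_le_real_part:
  assumes f: "\<And>c x. f (sX c x) = c * f x" and "0 \<le> b" and le: "\<And>x. inner 1 (f x) \<le> b * norm x"
  shows "onorm f \<le> b"
proof (rule onorm_bound[OF \<open>0 \<le> b\<close>], rule norm_le_real_part)
  fix x and k :: 's assume "norm k = 1"
  then show "inner 1 (k * f x) \<le> b * norm x"
    using le[of "sX k x"] by (simp add: f banach_space_over_facts(3)[OF sX])
qed

text \<open>That \<open>U x\<close> lies in \<open>L\<^sup>p\<close> is part of the claim, so \<open>T\<close> is tested with dual elements of truncations \<open>R n\<close> of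
\<open>U x\<close>. Each test bounds \<open>norm (R n) powr p\<close> by \<open>B * norm x * norm (R n) powr (p - 1)\<close>, and cancellation leaves a bound
that does not depend on \<open>n\<close>. Sigma-finiteness makes the truncations exhaust \<open>U x\<close>.\<close>

lemma analysis_bounded:
  assumes B: "0 \<le> B" "\<And>G. G \<in> Lp_space M q \<Longrightarrow> onorm (T G) \<le> B * Lp_norm M q G"
  shows "(\<lambda>\<omega>. \<Lambda> \<omega> x) \<in> Lp_space M p" "Lp_norm M p (\<lambda>\<omega>. \<Lambda> \<omega> x) \<le> B * norm x"
proof -
  define F where "F \<omega> = \<Lambda> \<omega> x" for \<omega>
  have bmF: "bochner_measurable M F" using bm[of x] by (simp add: F_def[abs_def])
  obtain g where g[measurable]: "g \<in> borel_measurable M" and gF: "AE \<omega> in M. norm (F \<omega>) = g \<omega>"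
    using norm_measurable_version[OF bmF] .
  obtain A :: "nat \<Rightarrow> 'w set" where A: "range A \<subseteq> sets M" "(\<Union>i. A i) = space M"
      "\<And>i. emeasure M (A i) \<noteq> \<infinity>" "incseq A"
    using sigma_finite_measure.sigma_finite_incseq[OF sf] by metis
  have [measurable]: "A n \<in> sets M" for n using A(1) by auto
  define E where "E n = {\<omega>\<in>space M. g \<omega> \<le> real n} \<inter> A n" for n
  have E[measurable]: "E n \<in> sets M" for n unfolding E_def by measurable
  define R where "R n \<omega> = indicat_real (E n) \<omega> *\<^sub>R F \<omega>" for n \<omega>
  have bmR: "bochner_measurable M (R n)" for n
  proof -
    have "bochner_measurable M (indicat_real (E n))" by (intro bochner_measurable_simple) simp
    then show ?thesis using bmF unfolding R_def
      by (intro bochner_measurable_continuous2[where h="\<lambda>a b. a *\<^sub>R b"]) (auto intro!: continuous_intros)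
  qed
  have RL: "R n \<in> Lp_space M p" for n
  proof -
    have "integrable C (\<lambda>\<omega>. norm (R n \<omega>) powr p)"
    proof (rule integrableI_bounded_set[where A="E n" and B="real n powr p"])
      show "(\<lambda>\<omega>. norm (R n \<omega>) powr p) \<in> borel_measurable C"
        using bochner_measurable_imp_borel[OF bmR[of n]] by measurable
      have "emeasure M (E n) \<le> emeasure M (A n)" by (rule emeasure_mono) (auto simp: E_def)
      also have "\<dots> < \<infinity>" using A(3)[of n] by (simp add: less_top)
      finally show "emeasure C (E n) < \<infinity>" by simp
      show "AE \<omega> in C. \<omega> \<in> E n \<longrightarrow> norm (norm (R n \<omega>) powr p) \<le> real n powr p"
        using AE_completion[OF gF]
      proof eventually_elim
        case (elim \<omega>)
        have "norm (R n \<omega>) \<le> real n" if "\<omega> \<in> E n" using elim that by (simp add: R_def E_def)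
        then show ?case using p by (simp add: powr_mono2)
      qed
    qed (auto simp: R_def)
    with bmR show ?thesis by (simp add: Lp_space_iff)
  qed
  have bound: "power_integral M p (R n) \<le> (B * norm x) powr p" for n
  proof -
    have "power_integral M p (R n) = gradient (R n) F"
      unfolding power_integral_def gradient_def
    proof (intro Bochner_Integration.integral_cong refl)
      fix \<omega>
      show "norm (R n \<omega>) powr p = re_ip (F \<omega>) (duality_map p (R n \<omega>))"
      proof (cases "\<omega> \<in> E n")
        case True
        then show ?thesis by (simp add: R_def re_ip_duality_map)
      next
        case False
        then show ?thesis
          by (simp add: R_def duality_map_def bounded_bilinear.zero_right[OF bounded_bilinear_re_ip])
      qed
    qed
    also have "\<dots> = inner 1 (T (dual_element (R n)) x)"
      unfolding re_synthesis_dual_element[OF RL] F_def ..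
    also have "\<dots> \<le> norm (T (dual_element (R n)) x)"
      using Cauchy_Schwarz_ineq2[of 1 "T (dual_element (R n)) x"] by simp
    also have "\<dots> \<le> onorm (T (dual_element (R n))) * norm x"
      by (rule onorm[OF synthesis_bounded_linear[OF dual_element_Lp[OF RL]]])
    also have "\<dots> \<le> (B * Lp_norm M q (dual_element (R n))) * norm x"
      by (intro mult_right_mono B(2) dual_element_Lp RL) simp
    also have "\<dots> = (B * norm x) * Lp_norm M p (R n) powr (p - 1)"
      by (simp add: dual_element_norm[OF RL])
    finally have le: "Lp_norm M p (R n) powr p \<le> (B * norm x) * Lp_norm M p (R n) powr (p - 1)"
      using Lp_norm_powr[OF RL] p by simp
    have "Lp_norm M p (R n) \<le> B * norm x"
    proof (cases "Lp_norm M p (R n) = 0")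
      case True
      then show ?thesis using B(1) by simp
    next
      case False
      then have pos: "0 < Lp_norm M p (R n)" using Lp_norm_nonneg[of M p "R n"] by simp
      then have "Lp_norm M p (R n) powr p = Lp_norm M p (R n) * Lp_norm M p (R n) powr (p - 1)"
        by (simp add: powr_mult_base)
      with le pos show ?thesis by simp
    qed
    then show ?thesis using Lp_norm_le_iff[OF RL] p B(1) by simp
  qed
  have "(\<integral>\<^sup>+\<omega>. ennreal (norm (F \<omega>) powr p) \<partial>C) \<le> (\<integral>\<^sup>+\<omega>. liminf (\<lambda>n. ennreal (norm (R n \<omega>) powr p)) \<partial>C)"
  proof (intro nn_integral_mono)
    fix \<omega> assume \<omega>: "\<omega> \<in> space C"
    then obtain n where n: "\<omega> \<in> A n" using A(2) by auto
    obtain m :: nat where m: "g \<omega> \<le> real m" using real_arch_simple by blast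
    have "\<forall>\<^sub>F k in sequentially. ennreal (norm (F \<omega>) powr p) = ennreal (norm (R k \<omega>) powr p)"
      using eventually_ge_at_top[of "max m n"]
    proof eventually_elim
      case (elim k)
      then have "\<omega> \<in> E k" using n m \<omega> incseqD[OF A(4), of n k] by (auto simp: E_def)
      then show ?case by (simp add: R_def)
    qed
    then have "(\<lambda>k. ennreal (norm (R k \<omega>) powr p)) \<longlonglongrightarrow> ennreal (norm (F \<omega>) powr p)"
      by (rule Lim_transform_eventually[OF tendsto_const])
    then show "ennreal (norm (F \<omega>) powr p) \<le> liminf (\<lambda>n. ennreal (norm (R n \<omega>) powr p))"
      using lim_imp_Liminf[OF sequentially_bot] by (metis order_refl)
  qed
  also have "\<dots> \<le> liminf (\<lambda>n. \<integral>\<^sup>+\<omega>. ennreal (norm (R n \<omega>) powr p) \<partial>C)"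
    using RL by (intro nn_integral_liminf) (auto simp: Lp_space_iff)
  also have "\<dots> \<le> liminf (\<lambda>n::nat. ennreal ((B * norm x) powr p))"
  proof (intro Liminf_mono always_eventually allI)
    fix n
    show "(\<integral>\<^sup>+\<omega>. ennreal (norm (R n \<omega>) powr p) \<partial>C) \<le> ennreal ((B * norm x) powr p)"
      using RL[of n] bound[of n] unfolding Lp_space_iff power_integral_def
      by (subst nn_integral_eq_integral) (auto intro: ennreal_leI)
  qed
  also have "\<dots> = ennreal ((B * norm x) powr p)" by (simp add: Liminf_const)
  finally have fin: "(\<integral>\<^sup>+\<omega>. ennreal (norm (F \<omega>) powr p) \<partial>C) \<le> ennreal ((B * norm x) powr p)" .
  then have FL: "F \<in> Lp_space M p"
    using bmF by (auto simp: Lp_space_def Lp_finite_def intro: le_less_trans)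
  have "power_integral M p F \<le> (B * norm x) powr p"
    using fin FL unfolding Lp_space_iff power_integral_def
    by (subst (asm) nn_integral_eq_integral) auto
  then have "Lp_norm M p F \<le> B * norm x" using B(1) p by (subst Lp_norm_le_iff[OF FL]) auto
  with FL show "(\<lambda>\<omega>. \<Lambda> \<omega> x) \<in> Lp_space M p" "Lp_norm M p (\<lambda>\<omega>. \<Lambda> \<omega> x) \<le> B * norm x"
    by (simp_all add: F_def[abs_def])
qed

lemma synthesis_bounded:
  assumes B: "0 \<le> B" "\<And>x. (\<lambda>\<omega>. \<Lambda> \<omega> x) \<in> Lp_space M p" "\<And>x. Lp_norm M p (\<lambda>\<omega>. \<Lambda> \<omega> x) \<le> B * norm x"
    and G: "G \<in> Lp_space M q"
  shows "onorm (T G) \<le> B * Lp_norm M q G"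
proof (rule onorm_bound)
  show "0 \<le> B * Lp_norm M q G" using B(1) Lp_norm_nonneg[of M q G] by simp
  fix x
  have "norm (T G x) \<le> (\<integral>\<omega>. norm (\<Lambda> \<omega> x) * norm (G \<omega>) \<partial>C)"
    unfolding synthesis_def
    using synthesis_integrable[OF G, of x] holder_Lp(1)[OF p q conj B(2)[of x] G] \<nu>_le
    by (intro order_trans[OF integral_norm_bound] integral_mono) (auto simp: mult.commute)
  also have "\<dots> \<le> Lp_norm M p (\<lambda>\<omega>. \<Lambda> \<omega> x) * Lp_norm M q G"
    by (rule holder_Lp(2)[OF p q conj B(2) G])
  also have "\<dots> \<le> (B * norm x) * Lp_norm M q G"
    by (intro mult_right_mono B(3) Lp_norm_nonneg)
  finally show "norm (T G x) \<le> B * Lp_norm M q G * norm x" by (simp add: mult_ac)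
qed


section \<open>Surjectivity of analysis and synthesis\<close>

text \<open>Lower semicontinuity without a triangle inequality in \<open>L\<^sup>p\<close>: the tangent at \<open>F - U y\<close> is a lower bound, and along the range
of \<open>U\<close> it is continuous because it is a value of \<open>T\<close>.\<close>

lemma power_integral_analysis_lsc:
  assumes U: "\<And>x. (\<lambda>\<omega>. \<Lambda> \<omega> x) \<in> Lp_space M p" and F: "F \<in> Lp_space M p" and e: "0 < e"
  shows "\<forall>\<^sub>F z in nhds y. power_integral M p (\<lambda>\<omega>. F \<omega> - \<Lambda> \<omega> y) - e < power_integral M p (\<lambda>\<omega>. F \<omega> - \<Lambda> \<omega> z)"
proof -
  let ?R = "\<lambda>z \<omega>. F \<omega> - \<Lambda> \<omega> z"
  have R: "?R z \<in> Lp_space M p" for z using F U p by (intro Lp_space_diff) auto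
  let ?f = "T (dual_element (?R y))"
  have lin: "bounded_linear ?f" by (rule synthesis_bounded_linear[OF dual_element_Lp[OF R]])
  have "((\<lambda>z. p * inner 1 (?f (y - z))) \<longlongrightarrow> p * inner 1 (?f (y - y))) (nhds y)"
    by (intro tendsto_intros bounded_linear.tendsto[OF lin] filterlim_ident)
  then have "((\<lambda>z. p * inner 1 (?f (y - z))) \<longlongrightarrow> 0) (nhds y)"
    using linear_0[OF bounded_linear.linear[OF lin]] by simp
  then have "\<forall>\<^sub>F z in nhds y. - e < p * inner 1 (?f (y - z))"
    by (rule order_tendstoD) (use e in simp)
  then show ?thesis
  proof eventually_elim
    case (elim z)
    have "gradient (?R y) (\<lambda>\<omega>. ?R z \<omega> - ?R y \<omega>) = gradient (?R y) (\<lambda>\<omega>. \<Lambda> \<omega> (y - z))"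
      unfolding gradient_def
      by (intro Bochner_Integration.integral_cong refl) (simp add: analysis_linear)
    also have "\<dots> = inner 1 (?f (y - z))" by (rule re_synthesis_dual_element[OF R, symmetric])
    finally show ?case using power_integral_gradient[OF R R, of y z] elim by simp
  qed
qed

text \<open>The surjectivity argument of Ekeland: at the point \<open>x\<close> supplied by his principle, a nonzero residual \<open>R = F - U x\<close> would have a dual
element \<open>R\<^sup>*\<close> with \<open>norm (T R\<^sup>*) \<le> \<epsilon> * norm R\<^sup>*\<close>, against the lower bound \<open>A > \<epsilon>\<close>.\<close>

lemma analysis_onto:
  assumes U: "\<And>x. (\<lambda>\<omega>. \<Lambda> \<omega> x) \<in> Lp_space M p"
    and A: "\<And>G. G \<in> Lp_space M q \<Longrightarrow> A * Lp_norm M q G \<le> onorm (T G)"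
    and F: "F \<in> Lp_space M p" and \<epsilon>: "0 < \<epsilon>" "\<epsilon> < A"
  obtains x where "\<epsilon> * norm x \<le> Lp_norm M p F" "AE \<omega> in M. F \<omega> = \<Lambda> \<omega> x"
proof -
  let ?R = "\<lambda>z \<omega>. F \<omega> - \<Lambda> \<omega> z"
  have R: "?R z \<in> Lp_space M p" for z using F U p by (intro Lp_space_diff) auto
  define \<psi> where "\<psi> z = Lp_norm M p (?R z)" for z
  have \<psi>0: "0 \<le> \<psi> z" for z by (simp add: \<psi>_def Lp_norm_nonneg)
  have \<psi>p: "\<psi> z powr p = power_integral M p (?R z)" for z
    unfolding \<psi>_def using Lp_norm_powr[OF R] p by simp
  have lsc: "\<forall>\<^sub>F z in nhds y. \<psi> y - e < \<psi> z" if e: "0 < e" for y e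
  proof (cases "\<psi> y - e < 0")
    case True
    then have "\<psi> y - e < \<psi> z" for z using \<psi>0[of z] by linarith
    then show ?thesis by simp
  next
    case False
    then have "(\<psi> y - e) powr p < \<psi> y powr p" using e p by (intro powr_less_mono2) auto
    then have "\<forall>\<^sub>F z in nhds y. power_integral M p (?R y) - (\<psi> y powr p - (\<psi> y - e) powr p)
        < power_integral M p (?R z)"
      by (intro power_integral_analysis_lsc[OF U F]) simp
    then show ?thesis
    proof eventually_elim
      case (elim z)
      then have "(\<psi> y - e) powr p < \<psi> z powr p" by (simp add: \<psi>p)
      then show ?case using \<psi>0[of z] p powr_mono2[of p "\<psi> z" "\<psi> y - e"] by fastforce
    qed
  qed
  obtain x where x0: "\<psi> x + \<epsilon> * dist 0 x \<le> \<psi> 0" and x: "\<And>y. \<psi> x - \<epsilon> * dist x y \<le> \<psi> y"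
    using ekeland_variational_principle[of 0 \<psi> \<epsilon> 0, OF \<psi>0 lsc \<epsilon>(1)] by metis
  define a where "a = \<psi> x"
  let ?G = "dual_element (?R x)"
  have G: "?G \<in> Lp_space M q" by (rule dual_element_Lp[OF R])
  have a0: "a = 0"
  proof (rule ccontr)
    assume "a \<noteq> 0"
    then have a: "0 < a" using \<psi>0[of x] by (simp add: a_def)
    have "inner 1 (T ?G v) \<le> (\<epsilon> * a powr (p - 1)) * norm v" for v
    proof -
      \<comment> \<open>Below \<open>\<delta>\<close> the bound \<open>a - \<epsilon> * t * norm v\<close> is nonnegative and may be raised to the power \<open>p\<close>; adding 1 avoids division by 0.\<close>
      define \<delta> where "\<delta> = a / (\<epsilon> * norm v + 1)"
      have d: "0 < \<epsilon> * norm v + 1" using \<epsilon>(1) by (simp add: add_nonneg_pos)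
      have \<delta>: "0 < \<delta>" using a d by (simp add: \<delta>_def)
      have V: "(\<lambda>\<omega>. - \<Lambda> \<omega> v) \<in> Lp_space M p" using Lp_space_scaleR[OF U, of "-1" v] p by simp
      have "- (p * a powr (p - 1) * (\<epsilon> * norm v)) \<le> p * gradient (?R x) (\<lambda>\<omega>. - \<Lambda> \<omega> v)"
      proof (rule directional_derivative_lower_bound[OF R V \<delta>])
        fix t assume t: "0 < t" "t < \<delta>"
        have "t * (\<epsilon> * norm v + 1) < a" using t(2) d by (simp add: \<delta>_def pos_less_divide_eq)
        then have nn: "0 \<le> a - \<epsilon> * (t * norm v)" using t(1) by (simp add: algebra_simps)
        have "a powr p - t * (p * a powr (p - 1) * (\<epsilon> * norm v)) \<le> (a - \<epsilon> * (t * norm v)) powr p"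
          using powr_gradient_le[OF p _ nn, of a] a by (simp add: algebra_simps)
        also have "\<dots> \<le> \<psi> (x + t *\<^sub>R v) powr p"
          using nn p x[of "x + t *\<^sub>R v"] t(1) by (intro powr_mono2) (auto simp: a_def dist_norm)
        also have "\<dots> = power_integral M p (\<lambda>\<omega>. ?R x \<omega> + t *\<^sub>R (- \<Lambda> \<omega> v))"
          unfolding \<psi>p power_integral_def
          by (intro Bochner_Integration.integral_cong refl) (simp add: analysis_linear diff_diff_eq)
        finally show "power_integral M p (?R x) - t * (p * a powr (p - 1) * (\<epsilon> * norm v)) \<le>
            power_integral M p (\<lambda>\<omega>. ?R x \<omega> + t *\<^sub>R (- \<Lambda> \<omega> v))"
          by (simp add: \<psi>p[symmetric] a_def)
      qed
      also have "gradient (?R x) (\<lambda>\<omega>. - \<Lambda> \<omega> v) = - inner 1 (T ?G v)"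
        unfolding re_synthesis_dual_element[OF R] gradient_def
        by (simp add: bounded_bilinear.minus_left[OF bounded_bilinear_re_ip])
      finally have "p * inner 1 (T ?G v) \<le> p * (\<epsilon> * a powr (p - 1) * norm v)"
        by (simp add: algebra_simps)
      then show ?thesis using p by (subst (asm) mult_le_cancel_left_pos) auto
    qed
    then have "onorm (T ?G) \<le> \<epsilon> * a powr (p - 1)"
      using \<epsilon>(1) synthesis_homogeneous[OF G] by (intro onorm_le_real_part) auto
    then have "A * a powr (p - 1) \<le> \<epsilon> * a powr (p - 1)"
      using A[OF G] dual_element_norm[OF R, of x] by (simp add: a_def \<psi>_def)
    then show False using a \<epsilon>(2) by (simp add: mult_le_cancel_right)
  qed
  show thesis
  proof
    have "AE \<omega> in M. ?R x \<omega> = 0" using a0 R by (intro Lp_norm_eq_0[of _ M p]) (auto simp: a_def \<psi>_def)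
    then show "AE \<omega> in M. F \<omega> = \<Lambda> \<omega> x" by eventually_elim simp
    have "\<psi> 0 = Lp_norm M p F"
      unfolding \<psi>_def by (rule Lp_norm_cong_AE) (simp add: analysis_linear)
    then show "\<epsilon> * norm x \<le> Lp_norm M p F" using x0 \<psi>0[of x] by simp
  qed
qed

lemma analysis_bounded_below:
  assumes U: "\<And>x. (\<lambda>\<omega>. \<Lambda> \<omega> x) \<in> Lp_space M p"
    and A: "\<And>G. G \<in> Lp_space M q \<Longrightarrow> A * Lp_norm M q G \<le> onorm (T G)"
    and inj: "\<And>x. AE \<omega> in M. \<Lambda> \<omega> x = 0 \<Longrightarrow> x = 0" and \<epsilon>: "0 < \<epsilon>" "\<epsilon> < A"
  shows "\<epsilon> * norm x \<le> Lp_norm M p (\<lambda>\<omega>. \<Lambda> \<omega> x)"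
proof -
  obtain y where y: "\<epsilon> * norm y \<le> Lp_norm M p (\<lambda>\<omega>. \<Lambda> \<omega> x)" "AE \<omega> in M. \<Lambda> \<omega> x = \<Lambda> \<omega> y"
    using analysis_onto[OF U A U \<epsilon>] by metis
  have "AE \<omega> in M. \<Lambda> \<omega> (x - y) = 0"
    using y(2) AE_space by eventually_elim (simp add: analysis_linear)
  then have "x - y = 0" by (rule inj)
  with y(1) show ?thesis by simp
qed

text \<open>The functional \<open>\<phi>\<close> has the Euler-Lagrange equation \<open>T (U x)\<^sup>* = f\<close>. Minimizers are not available directly, but
at a point that is minimal up to slope \<open>e\<close> this equation holds up to \<open>e\<close> in norm.\<close>

lemma synthesis_dense_range:
  assumes U: "\<And>x. (\<lambda>\<omega>. \<Lambda> \<omega> x) \<in> Lp_space M p"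
    and below: "\<And>x. a * norm x \<le> Lp_norm M p (\<lambda>\<omega>. \<Lambda> \<omega> x)" and a: "0 < a"
    and f: "f \<in> dual_space sX" and e: "0 < e"
  obtains G where "G \<in> Lp_space M q" "onorm (\<lambda>x. f x - T G x) \<le> e"
proof -
  have lin: "bounded_linear f" and hom: "\<And>c x. f (sX c x) = c * f x"
    using f by (auto simp: dual_space_iff[OF sX])
  interpret f: bounded_linear f by (rule lin)
  define N where "N x = power_integral M p (\<lambda>\<omega>. \<Lambda> \<omega> x)" for x
  define \<phi> where "\<phi> x = N x / p - inner 1 (f x)" for x
  have bdd: "- ((onorm f / a) powr q / q) \<le> \<phi> x" for x
  proof -
    have "inner 1 (f x) \<le> norm (f x)" using Cauchy_Schwarz_ineq2[of 1 "f x"] by simp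
    also have "\<dots> \<le> onorm f * norm x" by (rule onorm[OF lin])
    also have "\<dots> = (a * norm x) * (onorm f / a)" using a by simp
    also have "\<dots> \<le> (a * norm x) powr p / p + (onorm f / a) powr q / q"
      using a p q conj onorm_pos_le[OF lin] by (intro Youngs_inequality) auto
    also have "(a * norm x) powr p \<le> Lp_norm M p (\<lambda>\<omega>. \<Lambda> \<omega> x) powr p"
      using below[of x] a p by (intro powr_mono2) auto
    also have "\<dots> = N x" unfolding N_def using Lp_norm_powr[OF U] p by simp
    finally show ?thesis using p by (simp add: \<phi>_def divide_right_mono)
  qed
  have lsc: "\<forall>\<^sub>F z in nhds y. \<phi> y - d < \<phi> z" if d: "0 < d" for y d
  proof -
    have zero: "(\<lambda>\<omega>. 0::'k) \<in> Lp_space M p"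
      using Lp_space_scaleR[OF U, of 0 0] p by simp
    have N: "power_integral M p (\<lambda>\<omega>. 0 - \<Lambda> \<omega> z) = N z" for z by (simp add: N_def power_integral_def)
    have "\<forall>\<^sub>F z in nhds y. N y - p * (d / 2) < N z"
      using power_integral_analysis_lsc[OF U zero, of "p * (d / 2)" y] d p unfolding N by simp
    moreover have "((\<lambda>z. inner 1 (f z)) \<longlongrightarrow> inner 1 (f y)) (nhds y)"
      by (intro tendsto_intros f.tendsto filterlim_ident)
    then have "\<forall>\<^sub>F z in nhds y. inner 1 (f z) < inner 1 (f y) + d / 2"
      by (rule order_tendstoD) (use d in simp)
    ultimately show ?thesis
    proof eventually_elim
      case (elim z)
      have "(N y - p * (d / 2)) / p < N z / p" using elim(1) p by (intro divide_strict_right_mono) auto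
      then have "N y / p - d / 2 < N z / p" using p by (simp add: diff_divide_distrib)
      with elim(2) show ?case by (simp add: \<phi>_def)
    qed
  qed
  obtain x where x: "\<And>y. \<phi> x - e * dist x y \<le> \<phi> y"
    using ekeland_variational_principle[of _ \<phi> e 0, OF bdd lsc e] by metis
  let ?U = "\<lambda>x \<omega>. \<Lambda> \<omega> x"
  let ?G = "dual_element (?U x)"
  have G: "?G \<in> Lp_space M q" by (rule dual_element_Lp[OF U])
  have le: "inner 1 (f v - T ?G v) \<le> e * norm v" for v
  proof -
    have "- (p * (e * norm v - inner 1 (f v))) \<le> p * gradient (?U x) (?U v)"
    proof (rule directional_derivative_lower_bound[OF U U, of 1])
      fix t :: real assume t: "0 < t"
      have eq: "power_integral M p (\<lambda>\<omega>. \<Lambda> \<omega> x + t *\<^sub>R \<Lambda> \<omega> v) = N (x + t *\<^sub>R v)"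
        unfolding N_def power_integral_def
        by (intro Bochner_Integration.integral_cong refl) (simp add: analysis_linear)
      have "N x / p - t * (e * norm v - inner 1 (f v)) \<le> N (x + t *\<^sub>R v) / p"
        using x[of "x + t *\<^sub>R v"] t
        by (simp add: \<phi>_def dist_norm f.add f.scaleR inner_add_right algebra_simps)
      then have "p * (N x / p - t * (e * norm v - inner 1 (f v))) \<le> p * (N (x + t *\<^sub>R v) / p)"
        using p by (intro mult_left_mono) auto
      then show "power_integral M p (?U x) - t * (p * (e * norm v - inner 1 (f v))) \<le>
          power_integral M p (\<lambda>\<omega>. \<Lambda> \<omega> x + t *\<^sub>R \<Lambda> \<omega> v)"
        unfolding eq using p by (simp add: N_def[symmetric] algebra_simps)
    qed simp
    then have "p * (inner 1 (f v) - e * norm v) \<le> p * inner 1 (T ?G v)"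
      by (simp add: re_synthesis_dual_element[OF U] algebra_simps)
    then have "inner 1 (f v) - e * norm v \<le> inner 1 (T ?G v)"
      using p by (subst (asm) mult_le_cancel_left_pos) auto
    then show ?thesis by (simp add: inner_diff_right)
  qed
  have "onorm (\<lambda>v. f v - T ?G v) \<le> e"
    by (rule onorm_le_real_part) (use e le in \<open>auto simp: hom synthesis_homogeneous[OF G] right_diff_distrib\<close>)
  with G show thesis by (rule that)
qed

text \<open>Preimages of approximations to \<open>f\<close> form a Cauchy sequence because \<open>T\<close> is bounded below. They are first replaced by
simple functions, so that \<open>Lp_complete_simple\<close> applies.\<close>

lemma synthesis_onto:
  assumes U: "\<And>x. (\<lambda>\<omega>. \<Lambda> \<omega> x) \<in> Lp_space M p"
    and below: "\<And>x. a * norm x \<le> Lp_norm M p (\<lambda>\<omega>. \<Lambda> \<omega> x)" and a: "0 < a"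
    and A: "0 < A" "\<And>G. G \<in> Lp_space M q \<Longrightarrow> A * Lp_norm M q G \<le> onorm (T G)"
    and B: "0 < B" "\<And>G. G \<in> Lp_space M q \<Longrightarrow> onorm (T G) \<le> B * Lp_norm M q G"
    and f: "f \<in> dual_space sX"
  obtains G where "G \<in> Lp_space M q" "T G = f"
proof -
  have lin: "bounded_linear f" using f by (simp add: dual_space_iff[OF sX])
  have lin_diff: "bounded_linear (\<lambda>x. f x - T G x)" if "G \<in> Lp_space M q" for G
    by (intro bounded_linear_sub lin synthesis_bounded_linear that)
  have q0: "0 < q" using q by simp
  \<comment> \<open>Two approximants differ by \<open>4 * e n\<close> at most in the image, hence by \<open>(1/4) ^ n\<close> in \<open>L\<^sup>q\<close>.\<close>
  define e where "e n = A / 4 * (1/4) ^ n" for n :: nat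
  have e: "0 < e n" for n using A(1) by (simp add: e_def)
  have "\<exists>s. simple_function M s \<and> s \<in> Lp_space M q \<and> onorm (\<lambda>x. f x - T s x) \<le> 2 * e n" for n
  proof -
    obtain G where G: "G \<in> Lp_space M q" "onorm (\<lambda>x. f x - T G x) \<le> e n"
      using synthesis_dense_range[OF U below a f e] by metis
    \<comment> \<open>Passing to a simple function costs at most another \<open>e n\<close> in the image of \<open>T\<close>.\<close>
    obtain s where s: "simple_function M s" "s \<in> Lp_space M q" "Lp_norm M q (\<lambda>\<omega>. G \<omega> - s \<omega>) \<le> e n / B"
      using simple_dense_Lp[OF G(1) q0, of "e n / B"] e[of n] B(1) by (metis divide_pos_pos)
    have L: "(\<lambda>\<omega>. G \<omega> - s \<omega>) \<in> Lp_space M q" using G s q0 by (intro Lp_space_diff) auto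
    have "onorm (T (\<lambda>\<omega>. G \<omega> - s \<omega>)) \<le> e n"
      using B(2)[OF L] s(3) B(1) by (simp add: pos_le_divide_eq mult.commute)
    then have "onorm (\<lambda>x. (f x - T G x) + T (\<lambda>\<omega>. G \<omega> - s \<omega>) x) \<le> 2 * e n"
      using G(2) by (intro onorm_triangle_le lin_diff G(1) synthesis_bounded_linear L) simp
    then have "onorm (\<lambda>x. f x - T s x) \<le> 2 * e n" by (simp add: synthesis_diff[OF G(1) s(2)])
    with s show ?thesis by blast
  qed
  then obtain s where s: "\<And>n. simple_function M (s n)" and sL: "\<And>n. s n \<in> Lp_space M q"
    and close: "\<And>n. onorm (\<lambda>x. f x - T (s n) x) \<le> 2 * e n" by metis
  have fast: "Lp_norm M q (\<lambda>\<omega>. s m \<omega> - s n \<omega>) \<le> (1/4) ^ n" if "n \<le> m" for m n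
  proof -
    have L: "(\<lambda>\<omega>. s m \<omega> - s n \<omega>) \<in> Lp_space M q" using sL q0 by (intro Lp_space_diff) auto
    have neg: "onorm (\<lambda>x. - (f x - T (s m) x)) \<le> 2 * e m" unfolding onorm_neg by (rule close)
    have "e m \<le> e n" using that A(1) by (simp add: e_def power_decreasing)
    then have "onorm (\<lambda>x. (f x - T (s n) x) + - (f x - T (s m) x)) \<le> 4 * e n"
      using neg close[of n]
      by (intro onorm_triangle_le lin_diff sL bounded_linear_minus) simp
    then have "onorm (T (\<lambda>\<omega>. s m \<omega> - s n \<omega>)) \<le> 4 * e n" by (simp add: synthesis_diff[OF sL sL])
    then have "A * Lp_norm M q (\<lambda>\<omega>. s m \<omega> - s n \<omega>) \<le> A * (1/4) ^ n"
      using A(2)[OF L] by (simp add: e_def)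
    then show ?thesis using A(1) by (subst (asm) mult_le_cancel_left_pos) auto
  qed
  obtain G where G: "G \<in> Lp_space M q" and Gs: "\<And>n. Lp_norm M q (\<lambda>\<omega>. G \<omega> - s n \<omega>) \<le> (1/4) ^ n"
    using Lp_complete_simple[OF s sL q0 fast] by metis
  have "onorm (\<lambda>x. f x - T G x) \<le> (A / 2 + B) * (1/4) ^ n" for n
  proof -
    have L: "(\<lambda>\<omega>. s n \<omega> - G \<omega>) \<in> Lp_space M q" using sL G q0 by (intro Lp_space_diff) auto
    have "onorm (T (\<lambda>\<omega>. s n \<omega> - G \<omega>)) \<le> B * Lp_norm M q (\<lambda>\<omega>. s n \<omega> - G \<omega>)" by (rule B(2)[OF L])
    also have "\<dots> \<le> B * (1/4) ^ n"
      using Gs[of n] B(1) by (intro mult_left_mono) (auto simp: Lp_norm_minus_commute)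
    finally have "onorm (\<lambda>x. (f x - T (s n) x) + T (\<lambda>\<omega>. s n \<omega> - G \<omega>) x) \<le> (A / 2 + B) * (1/4) ^ n"
      using close[of n]
      by (intro onorm_triangle_le lin_diff sL synthesis_bounded_linear L) (simp add: e_def algebra_simps)
    then show ?thesis by (simp add: synthesis_diff[OF sL G])
  qed
  moreover have "(\<lambda>n. (A / 2 + B) * (1/4) ^ n) \<longlonglongrightarrow> 0"
    by (intro tendsto_mult_right_zero LIMSEQ_power_zero) simp
  ultimately have "onorm (\<lambda>x. f x - T G x) \<le> 0" by (intro LIMSEQ_le_const) auto
  then have "onorm (\<lambda>x. f x - T G x) = 0" using onorm_pos_le[OF lin_diff[OF G]] by simp
  then have "T G = f" using onorm_eq_0[OF lin_diff[OF G]] by (auto simp: fun_eq_iff)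
  with G show thesis by (rule that)
qed


section \<open>Riesz bases, invertibility and frames\<close>

lemma pg_frame_bounds_if_qg_riesz_bounds:
  assumes bounds: "qg_riesz_bounds M \<nu> q \<Lambda> A B"
    and inj: "\<And>x. AE \<omega> in M. \<Lambda> \<omega> x = 0 \<Longrightarrow> x = 0"
  shows "pg_frame_bounds M p \<Lambda> (A / 2) B"
proof -
  have A: "0 < A" "\<And>G. G \<in> Lp_space M q \<Longrightarrow> A * Lp_norm M q G \<le> onorm (T G)"
    and B: "0 < B" "\<And>G. G \<in> Lp_space M q \<Longrightarrow> onorm (T G) \<le> B * Lp_norm M q G"
    using bounds by (auto simp: qg_riesz_bounds_def)
  note upper = analysis_bounded[OF less_imp_le[OF B(1)] B(2)]
  have "A / 2 * norm x \<le> Lp_norm M p (\<lambda>\<omega>. \<Lambda> \<omega> x)" for x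
    using A(1) by (intro analysis_bounded_below[OF upper(1) A(2) inj]) auto
  then show ?thesis
    using A(1) B(1) upper by (auto simp: pg_frame_bounds_def Lp_space_def)
qed

text \<open>Together with \<open>pg_frame_bounds_if_qg_riesz_bounds\<close> this shows that the same constants occur as upper bounds of
both kinds, which is why the optimal ones agree.\<close>

lemma qg_riesz_bounds_with_frame_upper_bound:
  assumes "qg_riesz_bounds M \<nu> q \<Lambda> A B" "pg_frame_bounds M p \<Lambda> A' B'"
  shows "qg_riesz_bounds M \<nu> q \<Lambda> A B'"
proof -
  have B': "0 < B'" "Lp_norm M p (\<lambda>\<omega>. \<Lambda> \<omega> x) \<le> B' * norm x" "(\<lambda>\<omega>. \<Lambda> \<omega> x) \<in> Lp_space M p" for x
    using assms(2) bm by (auto simp: pg_frame_bounds_def Lp_space_def)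
  show ?thesis
    using assms(1) synthesis_bounded[OF less_imp_le[OF B'(1)] B'(3,2)] B'(1)
    by (auto simp: qg_riesz_bounds_def)
qed

lemma optimal_upper_bounds_agree:
  assumes opt: "optimal_upper_qg_riesz_bound M \<nu> q \<Lambda> B"
    and inj: "\<And>x. AE \<omega> in M. \<Lambda> \<omega> x = 0 \<Longrightarrow> x = 0"
  shows "optimal_upper_pg_frame_bound M p \<Lambda> B"
proof -
  obtain A where A: "qg_riesz_bounds M \<nu> q \<Lambda> A B"
    and min: "\<And>A' B'. qg_riesz_bounds M \<nu> q \<Lambda> A' B' \<Longrightarrow> B \<le> B'"
    using opt unfolding optimal_upper_qg_riesz_bound_def by blast
  show ?thesis
    unfolding optimal_upper_pg_frame_bound_def
    using pg_frame_bounds_if_qg_riesz_bounds[OF A inj] min[OF qg_riesz_bounds_with_frame_upper_bound[OF A]]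
    by blast
qed

lemma invertible_if_qg_riesz_bounds:
  assumes bounds: "qg_riesz_bounds M \<nu> q \<Lambda> A B"
    and inj: "\<And>x. AE \<omega> in M. \<Lambda> \<omega> x = 0 \<Longrightarrow> x = 0"
  shows "invertible_bounded_op_Lp_dual sX sK M q T"
proof -
  have A: "0 < A" "\<And>G. G \<in> Lp_space M q \<Longrightarrow> A * Lp_norm M q G \<le> onorm (T G)"
    and B: "0 < B" "\<And>G. G \<in> Lp_space M q \<Longrightarrow> onorm (T G) \<le> B * Lp_norm M q G"
    using bounds by (auto simp: qg_riesz_bounds_def)
  have frame: "0 < A / 2" "\<And>x. A / 2 * norm x \<le> Lp_norm M p (\<lambda>\<omega>. \<Lambda> \<omega> x)"
      "\<And>x. (\<lambda>\<omega>. \<Lambda> \<omega> x) \<in> Lp_space M p"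
    using pg_frame_bounds_if_qg_riesz_bounds[OF bounds inj] bm
    by (auto simp: pg_frame_bounds_def Lp_space_def)
  have q0: "0 \<le> q" using q by simp
  have T_inj: "AE \<omega> in M. F \<omega> = G \<omega>"
    if FG: "F \<in> Lp_space M q" "G \<in> Lp_space M q" "T F = T G" for F G
  proof -
    have L: "(\<lambda>\<omega>. F \<omega> - G \<omega>) \<in> Lp_space M q" using FG q0 by (intro Lp_space_diff) auto
    have "A * Lp_norm M q (\<lambda>\<omega>. F \<omega> - G \<omega>) \<le> 0"
      using A(2)[OF L] FG(3) by (simp add: synthesis_diff[OF FG(1,2)] onorm_zero)
    then have "Lp_norm M q (\<lambda>\<omega>. F \<omega> - G \<omega>) = 0"
      using A(1) Lp_norm_nonneg[of M q "\<lambda>\<omega>. F \<omega> - G \<omega>"] by (simp add: mult_le_0_iff)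
    from Lp_norm_eq_0[OF L this] show ?thesis by eventually_elim simp
  qed
  have "\<exists>G. G \<in> Lp_space M q \<and> T G = f" if "f \<in> dual_space sX" for f
    using synthesis_onto[OF frame(3,2,1) A B that] by metis
  then obtain S where S: "\<And>f. f \<in> dual_space sX \<Longrightarrow> S f \<in> Lp_space M q"
      "\<And>f. f \<in> dual_space sX \<Longrightarrow> T (S f) = f" by metis
  have scale_L: "(\<lambda>\<omega>. sK c (G \<omega>)) \<in> Lp_space M q" if G: "G \<in> Lp_space M q" for c G
  proof (rule Lp_spaceI_bound[OF _ G G q0, where c="norm c"])
    have "bounded_linear (sK c)"
    proof (rule bounded_linear_intro[of _ "norm c"])
      note K = banach_space_over_facts[OF banach_K]
      fix r :: real and x y
      show "sK c (x + y) = sK c x + sK c y" "norm (sK c x) \<le> norm x * norm c" by (simp_all add: K)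
      show "sK c (r *\<^sub>R x) = r *\<^sub>R sK c x"
        using K(6)[of c "of_real r" x] K(6)[of "of_real r" c x] K(2)
        by (simp add: mult.commute)
    qed
    then have "continuous_on UNIV (sK c)" by (rule linear_continuous_on)
    then show "bochner_measurable M (\<lambda>\<omega>. sK c (G \<omega>))"
      using G by (intro bochner_measurable_continuous[where h="sK c"]) (simp_all add: Lp_space_iff)
    show "AE \<omega> in M. norm (sK c (G \<omega>)) \<le> norm c * (norm (G \<omega>) + norm (G \<omega>))"
      by (intro AE_I2) (simp add: banach_space_over_facts(3)[OF banach_K] mult_left_mono)
  qed simp
  have dual_add: "(\<lambda>x. f x + g x) \<in> dual_space sX" if "f \<in> dual_space sX" "g \<in> dual_space sX" for f g
    using that by (auto simp: dual_space_iff[OF sX] distrib_left intro: bounded_linear_add)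
  have dual_scale: "(\<lambda>x. c * f x) \<in> dual_space sX" if "f \<in> dual_space sX" for c f
    using that by (auto simp: dual_space_iff[OF sX] mult.left_commute intro: bounded_linear_mult_const bounded_linear_const_mult)
  have "bounded_op_Lp_dual sX sK M q T"
    unfolding bounded_op_Lp_dual_def
    using synthesis_in_dual synthesis_cong_AE synthesis_add synthesis_scale B(2) by blast
  moreover have "bounded_op_dual_Lp sX sK M q S"
    unfolding bounded_op_dual_Lp_def
  proof (intro conjI ballI allI)
    show "S f \<in> Lp_space M q" if "f \<in> dual_space sX" for f by (rule S(1)[OF that])
    fix f assume f: "f \<in> dual_space sX"
    show "AE \<omega> in M. S (\<lambda>x. f x + g x) \<omega> = S f \<omega> + S g \<omega>" if g: "g \<in> dual_space sX" for g
      using f g q0 by (intro T_inj) (simp_all add: S dual_add Lp_space_add synthesis_add)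
    show "AE \<omega> in M. S (\<lambda>x. c * f x) \<omega> = sK c (S f \<omega>)" for c
      using f by (intro T_inj) (simp_all add: S dual_scale scale_L synthesis_scale)
  next
    have "Lp_norm M q (S f) \<le> 1 / A * onorm f" if "f \<in> dual_space sX" for f
      using A(2)[OF S(1)[OF that]] A(1) by (simp add: S(2)[OF that] field_simps)
    then show "\<exists>c. \<forall>f\<in>dual_space sX. Lp_norm M q (S f) \<le> c * onorm f" by blast
  qed
  moreover have "AE \<omega> in M. S (T G) \<omega> = G \<omega>" if "G \<in> Lp_space M q" for G
    using that by (intro T_inj) (simp_all add: S synthesis_in_dual)
  ultimately show ?thesis
    unfolding invertible_bounded_op_Lp_dual_def using S(2) by blast
qed

lemma qg_riesz_bounds_if_invertible:
  assumes "invertible_bounded_op_Lp_dual sX sK M q T"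
  shows "\<exists>A B. qg_riesz_bounds M \<nu> q \<Lambda> A B"
proof -
  obtain S where T: "bounded_op_Lp_dual sX sK M q T" and S: "bounded_op_dual_Lp sX sK M q S"
    and ST: "\<And>G. G \<in> Lp_space M q \<Longrightarrow> AE \<omega> in M. S (T G) \<omega> = G \<omega>"
    using assms unfolding invertible_bounded_op_Lp_dual_def by blast
  obtain B where B: "\<And>G. G \<in> Lp_space M q \<Longrightarrow> onorm (T G) \<le> B * Lp_norm M q G"
    using T unfolding bounded_op_Lp_dual_def by blast
  obtain c where c: "\<And>f. f \<in> dual_space sX \<Longrightarrow> Lp_norm M q (S f) \<le> c * onorm f"
    using S unfolding bounded_op_dual_Lp_def by blast
  have "1 / max c 1 * Lp_norm M q G \<le> onorm (T G)" if G: "G \<in> Lp_space M q" for G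
  proof -
    have "Lp_norm M q G = Lp_norm M q (S (T G))" using Lp_norm_cong_AE[OF ST[OF G]] by simp
    also have "\<dots> \<le> c * onorm (T G)" by (rule c[OF synthesis_in_dual[OF G]])
    also have "\<dots> \<le> max c 1 * onorm (T G)"
      by (intro mult_right_mono onorm_pos_le synthesis_bounded_linear G) simp
    finally show ?thesis by (simp add: field_simps)
  qed
  moreover have "onorm (T G) \<le> max B 1 * Lp_norm M q G" if "G \<in> Lp_space M q" for G
    using B[OF that] mult_right_mono[OF max.cobounded1[of B 1] Lp_norm_nonneg[of M q G]] by linarith
  ultimately have "qg_riesz_bounds M \<nu> q \<Lambda> (1 / max c 1) (max B 1)"
    by (auto simp: qg_riesz_bounds_def)
  then show ?thesis by blast
qed

lemma analysis_injective_if_invertible: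
  assumes inv: "invertible_bounded_op_Lp_dual sX sK M q T" and x: "AE \<omega> in M. \<Lambda> \<omega> x = 0"
  shows "x = 0"
proof (rule ccontr)
  assume "x \<noteq> 0"
  then obtain f where f: "f \<in> dual_space sX" "f x \<noteq> 0" using dual_space_separates[OF sX] by metis
  obtain S where "S f \<in> Lp_space M q" "T (S f) = f"
    using inv f(1) unfolding invertible_bounded_op_Lp_dual_def bounded_op_dual_Lp_def by blast
  with synthesis_zero_AE[OF _ x, of "S f"] f(2) show False by simp
qed

end

theorem proposition3p2:
  fixes M :: "'w measure"
    and sX :: "'s::{real_normed_field, euclidean_space} \<Rightarrow> 'x::banach \<Rightarrow> 'x"
    and sK :: "'s \<Rightarrow> 'k::banach \<Rightarrow> 'k"
    and ip :: "'k \<Rightarrow> 'k \<Rightarrow> 's"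
    and H :: "'w \<Rightarrow> 'k set"
    and \<nu> :: "'k \<Rightarrow> 'k \<Rightarrow> 's"
    and \<Lambda> :: "'w \<Rightarrow> 'x \<Rightarrow> 'k"
    and p q :: real
  assumes "sigma_finite_measure M"
    and "banach_space_over sX"
    and "hilbert_direct_sum sK ip (space M) H"
    and "isometric_dual_iso sK \<nu>"
    and "1 < q" and "1 / p + 1 / q = 1"
    and "operator_family sX sK (space M) H \<Lambda>"
  shows "((\<forall>x. bochner_measurable M (\<lambda>\<omega>. \<Lambda> \<omega> x)) \<longrightarrow>
           (bochner_qg_riesz_basis sX sK M H \<nu> q \<Lambda> \<longleftrightarrow>
              synthesis_well_defined sX M \<nu> q \<Lambda> \<and>
              invertible_bounded_op_Lp_dual sX sK M q (synthesis M \<nu> \<Lambda>)))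
       \<and> (bochner_qg_riesz_basis sX sK M H \<nu> q \<Lambda> \<longrightarrow>
           bochner_pg_frame sX sK M H p \<Lambda> \<and>
           (\<forall>B. optimal_upper_qg_riesz_bound M \<nu> q \<Lambda> B \<longrightarrow>
                optimal_upper_pg_frame_bound M p \<Lambda> B))"
proof -
  have setting: "synthesis_setting sK ip \<nu> M p q sX \<Lambda>"
    if "\<And>x. bochner_measurable M (\<lambda>\<omega>. \<Lambda> \<omega> x)" "synthesis_well_defined sX M \<nu> q \<Lambda>"
  proof (intro synthesis_setting.intro Lp_duality.intro hilbert_pairing.intro
      Lp_duality_axioms.intro synthesis_setting_axioms.intro)
    show "hilbert_space_over sK ip" using assms(3) unfolding hilbert_direct_sum_def by blast
    show "\<And>\<omega>. \<omega> \<in> space M \<Longrightarrow> \<Lambda> \<omega> \<in> bounded_ops sX sK"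
      using assms(7) unfolding operator_family_def by blast
  qed (fact assms that)+
  have forward: "invertible_bounded_op_Lp_dual sX sK M q (synthesis M \<nu> \<Lambda>) \<and>
      bochner_pg_frame sX sK M H p \<Lambda> \<and>
      (\<forall>B. optimal_upper_qg_riesz_bound M \<nu> q \<Lambda> B \<longrightarrow> optimal_upper_pg_frame_bound M p \<Lambda> B)"
    if basis: "bochner_qg_riesz_basis sX sK M H \<nu> q \<Lambda>"
  proof -
    have bm: "\<And>x. bochner_measurable M (\<lambda>\<omega>. \<Lambda> \<omega> x)" and wd: "synthesis_well_defined sX M \<nu> q \<Lambda>"
      and inj: "\<And>x. AE \<omega> in M. \<Lambda> \<omega> x = 0 \<Longrightarrow> x = 0"
      using basis unfolding bochner_qg_riesz_basis_def by blast+
    obtain A B where AB: "qg_riesz_bounds M \<nu> q \<Lambda> A B"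
      using basis unfolding bochner_qg_riesz_basis_def by blast
    interpret synthesis_setting sK ip \<nu> M p q sX \<Lambda> by (rule setting[OF bm wd])
    show ?thesis
      using invertible_if_qg_riesz_bounds[OF AB inj] pg_frame_bounds_if_qg_riesz_bounds[OF AB inj]
        optimal_upper_bounds_agree[OF _ inj] bm assms(7)
      unfolding bochner_pg_frame_def by blast
  qed
  have backward: "bochner_qg_riesz_basis sX sK M H \<nu> q \<Lambda>"
    if bm: "\<And>x. bochner_measurable M (\<lambda>\<omega>. \<Lambda> \<omega> x)" and wd: "synthesis_well_defined sX M \<nu> q \<Lambda>"
      and inv: "invertible_bounded_op_Lp_dual sX sK M q (synthesis M \<nu> \<Lambda>)"
  proof -
    interpret synthesis_setting sK ip \<nu> M p q sX \<Lambda> by (rule setting[OF bm wd])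
    have "{x. AE \<omega> in M. \<Lambda> \<omega> x = 0} = {0}"
      using analysis_injective_if_invertible[OF inv] by (auto simp: analysis_linear)
    then show ?thesis
      unfolding bochner_qg_riesz_basis_def
      using qg_riesz_bounds_if_invertible[OF inv] bm wd assms(7) by blast
  qed
  show ?thesis
    using forward backward unfolding bochner_qg_riesz_basis_def by blast
qed

end
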